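(* Let $S_{ij}$, $i,j=1,\dots,m$, be (bounded) generalized Stieltjes functions of order $\lambda>0$. Let the associated Stieltjes measures have densities $\varphi_{ij}$ such that $(\varphi_{ij}(v))_{i,j=1,\dots,m}$ is a positive semi-definite matrix for all $v>0$. Let $\boldsymbol{g}=(g_{ij}):\mathbb{R}^d\to[0,\infty)^{m\times m}$ and $\boldsymbol{f}=(f_{ij}):\mathbb{R}^l\to(0,\infty)^{m\times m}$ be conditionally negative definite functions. Then the function $\boldsymbol{G}:\mathbb{R}^d\times\mathbb{R}^l\to\mathbb{R}^{m\times m}$ with $$G_{ij}(\boldsymbol{h},\boldsymbol{u})=\frac{1}{f_{ij}(\boldsymbol{u})^r}\,S_{ij}\left(\frac{g_{ij}(\boldsymbol{h})}{f_{ij}(\boldsymbol{u})}\right),\quad(\boldsymbol{h},\boldsymbol{u})\in\mathbb{R}^d\times\mathbb{R}^l,\ i,j=1,\dots,m,$$ is an $m$-variate covariance function for $r\ge\lambda$.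
   Context: Here $d,l,m\in\mathbb{N}$. Bounded generalized Stieltjes function of order $\lambda>0$: a function $S:(0,\infty)\to[0,\infty)$ with a representation $S(x)=a+\int_{(0,\infty)}\frac{1}{(x+v)^\lambda}\,d\mu(v)$, $x>0$, where $a\ge0$ and $\mu$ (the Stieltjes measure) is a positive measure on $(0,\infty)$ with $\int_{(0,\infty)}v^{-\lambda}\,d\mu(v)<\infty$. Such a function is identified with its continuous extension to $[0,\infty)$. Densities are with respect to Lebesgue measure on $(0,\infty)$. Conditionally negative definite: $\boldsymbol{\gamma}:\mathbb{R}^p\to\mathbb{R}^{m\times m}$ is conditionally negative definite if (i) $\gamma_{ij}(\boldsymbol{h})=\gamma_{ji}(-\boldsymbol{h})$ for all $\boldsymbol{h}\in\mathbb{R}^p$, $i,j=1,\dots,m$, and (ii) $\sum_{i=1}^n\sum_{j=1}^n \boldsymbol{a}_i^\top\boldsymbol{\gamma}(\boldsymbol{x}_i-\boldsymbol{x}_j)\boldsymbol{a}_j\le 0$ for all $n\in\mathbb{N}$, $\boldsymbol{x}_1,\dots,\boldsymbol{x}_n\in\mathbb{R}^p$ and $\boldsymbol{a}_1,\dots,\boldsymbol{a}_n\in\mathbb{R}^m$ with $\boldsymbol{1}_m^\top\sum_{k=1}^n\boldsymbol{a}_k=0$, where $\boldsymbol{1}_m=(1,\dots,1)^\top\in\mathbb{R}^m$. An $m$-variate covariance function on $\mathbb{R}^p$ (here $p=d+l$, $\mathbb{R}^d\times\mathbb{R}^l\cong\mathbb{R}^{d+l}$) is a function $\boldsymbol{C}:\mathbb{R}^p\to\mathbb{R}^{m\times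 m}$ that is the covariance function $C_{ij}(\boldsymbol{k})=\mathrm{Cov}(Z_i(\boldsymbol{x}+\boldsymbol{k}),Z_j(\boldsymbol{x}))$ of a real $m$-variate second-order stationary random field (constant mean, and these covariances exist and depend only on $\boldsymbol{k}$); equivalently, $\boldsymbol{C}$ is positive definite: $C_{ij}(\boldsymbol{k})=C_{ji}(-\boldsymbol{k})$ and $\sum_{i,j=1}^n\boldsymbol{a}_i^\top\boldsymbol{C}(\boldsymbol{x}_i-\boldsymbol{x}_j)\boldsymbol{a}_j\ge0$ for all $n\in\mathbb{N}$, $\boldsymbol{x}_1,\dots,\boldsymbol{x}_n\in\mathbb{R}^p$, $\boldsymbol{a}_1,\dots,\boldsymbol{a}_n\in\mathbb{R}^m$.
   Formalization: The formal theorem also assumes that the matrix of additive constants a_ij in the representations of S_ij is positive semi-definite; otherwise the claim fails (m=2, zero measures, g=0, f_ij=1, a_11=a_22=0, a_12=a_21=1). *)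

theory Defs
  imports "HOL-Probability.Probability"
begin

definition psd_matrix :: "real ^ 'm ^ 'm \<Rightarrow> bool" where
  "psd_matrix A \<longleftrightarrow> transpose A = A \<and> (\<forall>x. 0 \<le> x \<bullet> (A *v x))"

definition cond_neg_def :: "('a::euclidean_space \<Rightarrow> real ^ 'm ^ 'm) \<Rightarrow> bool" where
  "cond_neg_def \<gamma> \<longleftrightarrow>
     (\<forall>h i j. \<gamma> h $ i $ j = \<gamma> (- h) $ j $ i) \<and>
     (\<forall>(n::nat) (x :: nat \<Rightarrow> 'a) (a :: nat \<Rightarrow> real ^ 'm).
        1 \<bullet> (\<Sum>k<n. a k) = 0 \<longrightarrow>
        (\<Sum>i<n. \<Sum>j<n. a i \<bullet> (\<gamma> (x i - x j) *v a j)) \<le> 0)"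

text \<open>
  The measure \<open>\<mu>\<close> lives on the half-line itself: its space is \<open>{0<..}\<close>.  The continuity
  condition fixes the value of \<open>S\<close> at \<open>0\<close>, i.e. \<open>S\<close> is identified with its continuous extension
  to \<open>{0..}\<close>; the values of \<open>S\<close> at negative arguments are irrelevant.

  The pair \<open>(a, \<mu>)\<close> is an argument because the theorem needs both components: the densities of
  the measures \<open>\<mu>\<^sub>i\<^sub>j\<close>, and positive semi-definiteness of the matrix of constants \<open>a\<^sub>i\<^sub>j\<close>.
  Without the latter the theorem fails: take \<open>\<mu>\<^sub>i\<^sub>j = 0\<close>, \<open>g = 0\<close>, \<open>f\<^sub>i\<^sub>j = 1\<close>, \<open>a\<^sub>i\<^sub>i = 0\<close>, and
  \<open>a\<^sub>i\<^sub>j = 1\<close> for \<open>i \<noteq> j\<close>; then \<open>G\<close> is the constant matrix \<open>a\<close>, which is not a covariance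
  function for \<open>m \<ge> 2\<close>.
\<close>

definition bounded_gen_stieltjes_rep ::
    "real \<Rightarrow> (real \<Rightarrow> real) \<Rightarrow> real \<Rightarrow> real measure \<Rightarrow> bool" where
  "bounded_gen_stieltjes_rep lam S a \<mu> \<longleftrightarrow>
     0 \<le> a \<and>
     sets \<mu> = sets (restrict_space borel {0<..}) \<and>
     (\<integral>\<^sup>+ v. ennreal (v powr (- lam)) \<partial>\<mu>) < \<infinity> \<and>
     (\<forall>x>0. S x = a + (\<integral>v. 1 / (x + v) powr lam \<partial>\<mu>)) \<and>
     continuous_on {0..} S"

text \<open>
  Nonnegativity (almost everywhere) has to be demanded explicitly, because \<^const>\<open>ennreal\<close>
  truncates negative numbers to \<open>0\<close>.
\<close>

definition has_density_on_pos :: "real measure \<Rightarrow> (real \<Rightarrow> real) \<Rightarrow> bool" where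
  "has_density_on_pos \<mu> \<phi> \<longleftrightarrow>
     \<phi> \<in> borel_measurable (restrict_space lborel {0<..}) \<and>
     (AE v in restrict_space lborel {0<..}. 0 \<le> \<phi> v) \<and>
     \<mu> = density (restrict_space lborel {0<..}) (\<lambda>v. ennreal (\<phi> v))"

definition covariance :: "'w measure \<Rightarrow> ('w \<Rightarrow> real) \<Rightarrow> ('w \<Rightarrow> real) \<Rightarrow> real" where
  "covariance M X Y = (\<integral>\<omega>. (X \<omega> - (\<integral>\<omega>. X \<omega> \<partial>M)) * (Y \<omega> - (\<integral>\<omega>. Y \<omega> \<partial>M)) \<partial>M)"

definition stationary_field_with_cov ::
    "'w measure \<Rightarrow> ('a::euclidean_space \<Rightarrow> 'w \<Rightarrow> real ^ 'm) \<Rightarrow> ('a \<Rightarrow> real ^ 'm ^ 'm) \<Rightarrow> bool" where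
  "stationary_field_with_cov M Z C \<longleftrightarrow>
     prob_space M \<and>
     (\<forall>x. Z x \<in> borel_measurable M) \<and>
     (\<forall>x i. integrable M (\<lambda>\<omega>. (Z x \<omega> $ i)\<^sup>2)) \<and>
     (\<exists>c :: real ^ 'm. \<forall>x i. (\<integral>\<omega>. Z x \<omega> $ i \<partial>M) = c $ i) \<and>
     (\<forall>k x i j. C k $ i $ j = covariance M (\<lambda>\<omega>. Z (x + k) \<omega> $ i) (\<lambda>\<omega>. Z x \<omega> $ j))"

text \<open>
  One cannot quantify existentially over the type of the sample space, so the sample space is
  taken to consist of paths.  This is no restriction, since every random field can be replaced
  by the coordinate process under its law; see \<open>stationary_field_imp_covariance_function\<close>.
\<close>

definition covariance_function :: "('a::euclidean_space \<Rightarrow> real ^ 'm ^ 'm) \<Rightarrow> bool" where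
  "covariance_function C \<longleftrightarrow>
     (\<exists>(M :: ('a \<Rightarrow> real ^ 'm) measure) (Z :: 'a \<Rightarrow> ('a \<Rightarrow> real ^ 'm) \<Rightarrow> real ^ 'm).
        stationary_field_with_cov M Z C)"

lemma stationary_field_imp_covariance_function:
  fixes M :: "'w measure" and C :: "'a::euclidean_space \<Rightarrow> real ^ 'm ^ 'm"
  assumes "stationary_field_with_cov M Z C"
  shows "covariance_function C"
proof -
  have prob: "prob_space M" and Z[measurable]: "\<And>x. Z x \<in> borel_measurable M"
    and sq: "\<And>x i. integrable M (\<lambda>\<omega>. (Z x \<omega> $ i)\<^sup>2)"
    and cov: "\<And>k x i j. C k $ i $ j = covariance M (\<lambda>\<omega>. Z (x + k) \<omega> $ i) (\<lambda>\<omega>. Z x \<omega> $ j)"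
    using assms by (auto simp: stationary_field_with_cov_def)
  obtain c :: "real ^ 'm" where c: "\<And>x i. (\<integral>\<omega>. Z x \<omega> $ i \<partial>M) = c $ i"
    using assms by (auto simp: stationary_field_with_cov_def)
  define P where "P = PiM (UNIV :: 'a set) (\<lambda>_. borel :: (real ^ 'm) measure)"
  define T where "T = (\<lambda>\<omega> x. Z x \<omega>)"
  define N where "N = distr M P T"
  have T: "T \<in> measurable M P"
    unfolding T_def P_def by (rule measurable_PiM_single') auto
  have coord: "(\<lambda>w. w x) \<in> borel_measurable P" for x
    unfolding P_def by (rule measurable_component_singleton) simp
  have vnth: "(\<lambda>v::real ^ 'm. v $ i) \<in> borel_measurable borel" for i
    by (intro borel_measurable_continuous_onI continuous_intros)
  have coordi[measurable]: "(\<lambda>w. w x $ i) \<in> borel_measurable P" for x i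
    using measurable_compose[OF coord vnth] .
  have mean: "(\<integral>w. w x $ i \<partial>N) = (\<integral>\<omega>. Z x \<omega> $ i \<partial>M)" for x i
    unfolding N_def by (subst integral_distr[OF T]) (simp_all add: T_def)
  have covN: "covariance N (\<lambda>w. w x $ i) (\<lambda>w. w y $ j)
      = covariance M (\<lambda>\<omega>. Z x \<omega> $ i) (\<lambda>\<omega>. Z y \<omega> $ j)" for x y i j
    unfolding covariance_def mean unfolding N_def
    by (subst integral_distr[OF T]) (simp_all add: T_def)
  have "stationary_field_with_cov N (\<lambda>x w. w x) C"
    unfolding stationary_field_with_cov_def
  proof (intro conjI allI)
    show "prob_space N"
      unfolding N_def by (rule prob_space.prob_space_distr[OF prob T])
    show "(\<lambda>w. w x) \<in> borel_measurable N" for x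
      unfolding N_def using coord by simp
    show "integrable N (\<lambda>w. (w x $ i)\<^sup>2)" for x i
      unfolding N_def by (subst integrable_distr_eq[OF T]) (simp_all add: T_def sq)
    show "\<exists>c :: real ^ 'm. \<forall>x i. (\<integral>w. w x $ i \<partial>N) = c $ i"
      by (intro exI[of _ c]) (simp add: mean c)
    show "C k $ i $ j = covariance N (\<lambda>w. w (x + k) $ i) (\<lambda>w. w x $ j)" for k x i j
      by (simp add: covN cov)
  qed
  then show ?thesis
    unfolding covariance_function_def by blast
qed

end

theory Submission
  imports Defs
begin

text \<open>
  A matrix-valued function on a Euclidean space is a covariance function as soon as the scalar
  kernel \<open>((x, i), (y, j)) \<mapsto> C\<^sub>i\<^sub>j(x - y)\<close>, whose points are pairs of a location and a component
  index, is positive semidefinite. Working with scalar kernels on arbitrary sets removes the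
  matrix structure from the rest of the argument. It also turns conditional negative definiteness
  into Schoenberg's scalar notion, because the coefficients are required to sum to \<open>0\<close> over locations
  and components together.

  Inserting the Stieltjes representation and cancelling \<open>f\<close> gives
  \[ f^{-r} S(g/f) = a f^{-r} + \int_0^\infty \varphi(v) \, f^{-(r-\lambda)} \, (g + v f)^{-\lambda} \, dv \]
  entrywise (\<open>scaled_stieltjes_eq\<close>). For every \<open>v > 0\<close> the kernels \<open>f\<close> and \<open>g + v f\<close> are positive and
  conditionally negative definite, and a power \<open>L powr (- s)\<close> with \<open>s \<ge> 0\<close> of such a kernel is
  positive semidefinite (\<open>psd_kernel_powr_neg\<close>): it is a mixture of the kernels \<open>exp (- t L)\<close> by
  Euler's integral for the Gamma function, and these are positive semidefinite by Schoenberg's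
  theorem (\<open>psd_kernel_exp_neg\<close>). The condition \<open>r \<ge> \<lambda>\<close> is what makes the exponent \<open>-(r - \<lambda>)\<close>
  nonpositive. The Schur product theorem (\<open>psd_kernel_mult\<close>) multiplies these kernels with each
  other and with the matrices \<open>a\<close> and \<open>\<phi> v\<close>, and integration over \<open>v\<close> preserves positivity.

  What remains is to realize a positive semidefinite kernel by a random field
  (\<open>psd_kernel_imp_field\<close>). Since \<open>f\<close> and \<open>g\<close> can be arbitrarily irregular, the kernel lives on an
  unstructured uncountable set. Only the first and second moments are prescribed, so the problem is
  one of Hilbert space geometry: find vectors in the mean-zero part of some \<open>L\<^sup>2\<close> with given inner
  products. An orthonormal family \<open>\<xi>\<^sub>x\<close> of coin tosses is fixed, and a transfinite Gram-Schmidt construction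
  adds one point after the other: \<open>Z\<^sub>x\<close> is the projection prescribed by the covariances with the
  variables already constructed, plus a multiple of the fresh variable \<open>\<xi>\<^sub>x\<close> that corrects the
  variance. The projection exists because \<open>L\<^sup>2\<close> is complete (\<open>Riesz_L2\<close>), and Zorn's lemma carries
  the construction through the whole index set. The same realization also yields the Schur
  product theorem.
\<close>

section \<open>Square-integrable random variables\<close>

definition square_integrable :: "'w measure \<Rightarrow> ('w \<Rightarrow> real) \<Rightarrow> bool" where
  "square_integrable M X \<longleftrightarrow> X \<in> borel_measurable M \<and> integrable M (\<lambda>\<omega>. (X \<omega>)\<^sup>2)"

lemma square_integrable_measurable [measurable_dest]:
  "square_integrable M X \<Longrightarrow> X \<in> borel_measurable M"
  by (simp add: square_integrable_def)

lemma integrable_mult_square_integrable: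
  assumes "square_integrable M X" "square_integrable M Y"
  shows "integrable M (\<lambda>\<omega>. X \<omega> * Y \<omega>)"
proof (rule Bochner_Integration.integrable_bound)
  show "integrable M (\<lambda>\<omega>. (X \<omega>)\<^sup>2 + (Y \<omega>)\<^sup>2)"
    using assms by (auto simp: square_integrable_def)
  show "(\<lambda>\<omega>. X \<omega> * Y \<omega>) \<in> borel_measurable M"
    using assms[THEN square_integrable_measurable] by measurable
  have "\<bar>x * y\<bar> \<le> x\<^sup>2 + y\<^sup>2" for x y :: real
    using sum_squares_bound[of "\<bar>x\<bar>" "\<bar>y\<bar>"] mult_nonneg_nonneg[OF abs_ge_zero abs_ge_zero, of x y]
    unfolding abs_mult power2_abs by linarith
  then show "AE \<omega> in M. norm (X \<omega> * Y \<omega>) \<le> norm ((X \<omega>)\<^sup>2 + (Y \<omega>)\<^sup>2)"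
    by (intro AE_I2) simp
qed

lemma square_integrable_add:
  assumes "square_integrable M X" "square_integrable M Y"
  shows "square_integrable M (\<lambda>\<omega>. X \<omega> + Y \<omega>)"
  unfolding square_integrable_def power2_sum
  using assms integrable_mult_square_integrable[OF assms]
  by (auto simp: square_integrable_def mult.assoc)

lemma square_integrable_cmult:
  assumes "square_integrable M X"
  shows "square_integrable M (\<lambda>\<omega>. c * X \<omega>)"
  using assms by (auto simp: square_integrable_def power_mult_distrib)

lemma square_integrable_diff:
  assumes "square_integrable M X" "square_integrable M Y"
  shows "square_integrable M (\<lambda>\<omega>. X \<omega> - Y \<omega>)"
  using square_integrable_add[OF assms(1) square_integrable_cmult[OF assms(2), of "-1"]] by simp

lemma square_integrable_sum:
  assumes "\<And>y. y \<in> F \<Longrightarrow> square_integrable M (X y)"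
  shows "square_integrable M (\<lambda>\<omega>. \<Sum>y\<in>F. X y \<omega>)"
  using assms
proof (induction F rule: infinite_finite_induct)
  case (insert x F)
  then show ?case by (auto intro!: square_integrable_add)
qed (auto simp: square_integrable_def)

lemma (in prob_space) square_integrable_integrable:
  "square_integrable M X \<Longrightarrow> integrable M X"
  unfolding square_integrable_def by (elim conjE) (rule square_integrable_imp_integrable)

lemma Cauchy_Schwarz_integral:
  assumes "square_integrable M X" "square_integrable M Y"
  shows "\<bar>\<integral>\<omega>. X \<omega> * Y \<omega> \<partial>M\<bar> \<le> sqrt (\<integral>\<omega>. (X \<omega>)\<^sup>2 \<partial>M) * sqrt (\<integral>\<omega>. (Y \<omega>)\<^sup>2 \<partial>M)"
proof -
  let ?x = "\<integral>\<omega>. (X \<omega>)\<^sup>2 \<partial>M" and ?y = "\<integral>\<omega>. (Y \<omega>)\<^sup>2 \<partial>M" and ?z = "\<integral>\<omega>. X \<omega> * Y \<omega> \<partial>M"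
  have int: "integrable M (\<lambda>\<omega>. (X \<omega>)\<^sup>2)" "integrable M (\<lambda>\<omega>. (Y \<omega>)\<^sup>2)"
    "integrable M (\<lambda>\<omega>. X \<omega> * Y \<omega>)"
    using assms integrable_mult_square_integrable[OF assms] by (auto simp: square_integrable_def)
  have "0 \<le> (\<integral>\<omega>. (s * X \<omega> + t * Y \<omega>)\<^sup>2 \<partial>M)" for s t by simp
  also have "(\<integral>\<omega>. (s * X \<omega> + t * Y \<omega>)\<^sup>2 \<partial>M)
      = (\<integral>\<omega>. s\<^sup>2 * (X \<omega>)\<^sup>2 + t\<^sup>2 * (Y \<omega>)\<^sup>2 + 2 * s * t * (X \<omega> * Y \<omega>) \<partial>M)" for s t
    by (rule Bochner_Integration.integral_cong) (auto simp: power2_eq_square algebra_simps)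
  also have "\<dots> s t = s\<^sup>2 * ?x + t\<^sup>2 * ?y + 2 * s * t * ?z" for s t
    using int by simp
  finally have q: "0 \<le> s\<^sup>2 * ?x + t\<^sup>2 * ?y + 2 * s * t * ?z" for s t .
  have nn: "0 \<le> ?x" "0 \<le> ?y" by simp_all
  have "?z\<^sup>2 \<le> ?x * ?y"
  proof (cases "?y = 0")
    case True
    have "?z = 0"
    proof (rule ccontr)
      assume z: "?z \<noteq> 0"
      show False
        using q[of 1 "- (?x + 1) / (2 * ?z)"] True z nn by (simp add: field_simps)
    qed
    then show ?thesis using nn by simp
  next
    case False
    then have pos: "?y > 0" using nn by linarith
    have "0 \<le> ?y * (?x * ?y - ?z\<^sup>2)"
      using q[of ?y "- ?z"] by (simp add: power2_eq_square algebra_simps)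
    then show ?thesis using pos by (simp add: zero_le_mult_iff)
  qed
  then show ?thesis
    by (metis real_sqrt_abs real_sqrt_le_iff real_sqrt_mult)
qed

text \<open>
  Continuity of the inner product of \<open>L\<^sup>2\<close> in its first argument: all orthogonality relations and
  covariances that hold along an approximating sequence pass to its limit.
\<close>

lemma tendsto_expectation_mult:
  assumes W: "\<And>n. square_integrable M (W n)" and U: "square_integrable M U"
    and X: "square_integrable M X"
    and lim: "(\<lambda>n. \<integral>\<omega>. (W n \<omega> - U \<omega>)\<^sup>2 \<partial>M) \<longlonglongrightarrow> 0"
  shows "(\<lambda>n. \<integral>\<omega>. W n \<omega> * X \<omega> \<partial>M) \<longlonglongrightarrow> (\<integral>\<omega>. U \<omega> * X \<omega> \<partial>M)"
proof (rule LIM_zero_cancel)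
  let ?b = "\<lambda>n. sqrt (\<integral>\<omega>. (W n \<omega> - U \<omega>)\<^sup>2 \<partial>M) * sqrt (\<integral>\<omega>. (X \<omega>)\<^sup>2 \<partial>M)"
  have "?b \<longlonglongrightarrow> sqrt 0 * sqrt (\<integral>\<omega>. (X \<omega>)\<^sup>2 \<partial>M)"
    by (intro tendsto_intros lim)
  then have b: "?b \<longlonglongrightarrow> 0" by simp
  have eq: "(\<integral>\<omega>. W n \<omega> * X \<omega> \<partial>M) - (\<integral>\<omega>. U \<omega> * X \<omega> \<partial>M)
      = (\<integral>\<omega>. (W n \<omega> - U \<omega>) * X \<omega> \<partial>M)" for n
    using integrable_mult_square_integrable[OF W X, of n] integrable_mult_square_integrable[OF U X]
    by (simp add: left_diff_distrib)
  show "(\<lambda>n. (\<integral>\<omega>. W n \<omega> * X \<omega> \<partial>M) - (\<integral>\<omega>. U \<omega> * X \<omega> \<partial>M)) \<longlonglongrightarrow> 0"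
    by (rule Lim_null_comparison[OF _ b])
       (use Cauchy_Schwarz_integral[OF square_integrable_diff[OF W U] X] in \<open>auto simp: eq\<close>)
qed

text \<open>
  The Cauchy condition comes as a bound by \<open>e m + e n\<close>, which is the form that the parallelogram law
  delivers. On a probability space such a sequence is Cauchy in \<open>L\<^sup>1\<close>, hence a subsequence
  converges almost everywhere; Fatou's lemma turns this into convergence of the whole sequence
  in \<open>L\<^sup>2\<close>.
\<close>

lemma (in prob_space) L2_complete:
  assumes W: "\<And>n. square_integrable M (W n)"
    and e: "\<And>m n. (\<integral>\<omega>. (W m \<omega> - W n \<omega>)\<^sup>2 \<partial>M) \<le> e m + e n" and e0: "e \<longlonglongrightarrow> (0::real)"
  obtains U where "square_integrable M U" "(\<lambda>n. \<integral>\<omega>. (W n \<omega> - U \<omega>)\<^sup>2 \<partial>M) \<longlonglongrightarrow> 0"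
proof -
  have [measurable]: "W n \<in> borel_measurable M" for n
    using W by (rule square_integrable_measurable)
  have D: "square_integrable M (\<lambda>\<omega>. W m \<omega> - W n \<omega>)" for m n
    by (intro square_integrable_diff W)
  \<comment> \<open>Cauchy-Schwarz against the constant \<open>1\<close>\<close>
  have L1: "(\<integral>\<omega>. \<bar>W m \<omega> - W n \<omega>\<bar> \<partial>M) \<le> sqrt (e m + e n)" for m n
  proof -
    have "square_integrable M (\<lambda>\<omega>. \<bar>W m \<omega> - W n \<omega>\<bar>)"
      using D[of m n] by (simp add: square_integrable_def)
    moreover have "square_integrable M (\<lambda>\<omega>. 1)" by (simp add: square_integrable_def)
    ultimately have "\<bar>\<integral>\<omega>. \<bar>W m \<omega> - W n \<omega>\<bar> * 1 \<partial>M\<bar> \<le> sqrt (\<integral>\<omega>. (\<bar>W m \<omega> - W n \<omega>\<bar>)\<^sup>2 \<partial>M) * sqrt (\<integral>\<omega>. 1\<^sup>2 \<partial>M)"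
      by (rule Cauchy_Schwarz_integral)
    also have "\<dots> \<le> sqrt (e m + e n)" using e[of m n] by (simp add: prob_space)
    finally show ?thesis by simp
  qed
  have cau: "\<exists>N. \<forall>i\<ge>N. \<forall>j\<ge>N. (\<integral>\<omega>. norm (W i \<omega> - W j \<omega>) \<partial>M) < d" if "d > 0" for d
  proof -
    from e0 have "\<forall>\<^sub>F n in sequentially. e n < d\<^sup>2 / 2"
      by (rule order_tendstoD) (use that in simp)
    then obtain N where N: "\<And>n. n \<ge> N \<Longrightarrow> e n < d\<^sup>2 / 2"
      by (auto simp: eventually_sequentially)
    have "sqrt (e i + e j) < d" if "i \<ge> N" "j \<ge> N" for i j
      using N[OF that(1)] N[OF that(2)] \<open>d > 0\<close> by (intro real_less_lsqrt) auto
    then show ?thesis using L1 by (auto intro!: exI[of _ N] order.strict_trans1[OF L1])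
  qed
  from cauchy_L1_AE_cauchy_subseq[OF square_integrable_integrable[OF W] cau]
  obtain r where r: "strict_mono r" "AE \<omega> in M. Cauchy (\<lambda>i. W (r i) \<omega>)" by blast
  define U where "U \<omega> = lim (\<lambda>i. W (r i) \<omega>)" for \<omega>
  have [measurable]: "U \<in> borel_measurable M" unfolding U_def by measurable
  have AEU: "AE \<omega> in M. (\<lambda>i. W (r i) \<omega>) \<longlonglongrightarrow> U \<omega>"
    using r(2) by eventually_elim (auto simp: U_def Cauchy_convergent_iff convergent_LIMSEQ_iff)
  \<comment> \<open>let \<open>m\<close> run to infinity along the subsequence in the Cauchy condition\<close>
  have fatou: "(\<integral>\<^sup>+\<omega>. ennreal ((W n \<omega> - U \<omega>)\<^sup>2) \<partial>M) \<le> ennreal (e n)" for n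
  proof -
    have "(\<integral>\<^sup>+\<omega>. ennreal ((W n \<omega> - U \<omega>)\<^sup>2) \<partial>M)
        = (\<integral>\<^sup>+\<omega>. liminf (\<lambda>i. ennreal ((W n \<omega> - W (r i) \<omega>)\<^sup>2)) \<partial>M)"
    proof (rule nn_integral_cong_AE)
      show "AE \<omega> in M. ennreal ((W n \<omega> - U \<omega>)\<^sup>2) = liminf (\<lambda>i. ennreal ((W n \<omega> - W (r i) \<omega>)\<^sup>2))"
        using AEU
      proof eventually_elim
        case (elim \<omega>)
        have "(\<lambda>i. ennreal ((W n \<omega> - W (r i) \<omega>)\<^sup>2)) \<longlonglongrightarrow> ennreal ((W n \<omega> - U \<omega>)\<^sup>2)"
          by (intro tendsto_ennrealI tendsto_intros elim)
        then show ?case by (intro lim_imp_Liminf[symmetric]) simp_all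
      qed
    qed
    also have "\<dots> \<le> liminf (\<lambda>i. \<integral>\<^sup>+\<omega>. ennreal ((W n \<omega> - W (r i) \<omega>)\<^sup>2) \<partial>M)"
      by (rule nn_integral_liminf) measurable
    also have "\<dots> \<le> liminf (\<lambda>i. ennreal (e n + e (r i)))"
    proof (intro Liminf_mono always_eventually allI)
      fix i
      have "(\<integral>\<^sup>+\<omega>. ennreal ((W n \<omega> - W (r i) \<omega>)\<^sup>2) \<partial>M) = ennreal (\<integral>\<omega>. (W n \<omega> - W (r i) \<omega>)\<^sup>2 \<partial>M)"
        using D[of n "r i"] by (intro nn_integral_eq_integral) (auto simp: square_integrable_def)
      also have "\<dots> \<le> ennreal (e n + e (r i))" by (intro ennreal_leI e)
      finally show "(\<integral>\<^sup>+\<omega>. ennreal ((W n \<omega> - W (r i) \<omega>)\<^sup>2) \<partial>M) \<le> ennreal (e n + e (r i))" .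
    qed
    also have "liminf (\<lambda>i. ennreal (e n + e (r i))) = ennreal (e n + 0)"
      using LIMSEQ_subseq_LIMSEQ[OF e0 r(1)]
      by (intro lim_imp_Liminf tendsto_ennrealI tendsto_intros) (auto simp: o_def)
    finally show ?thesis by simp
  qed
  have sq: "integrable M (\<lambda>\<omega>. (W n \<omega> - U \<omega>)\<^sup>2)" for n
    using fatou[of n] by (intro integrableI_nonneg) (auto simp: le_less_trans)
  then have D': "square_integrable M (\<lambda>\<omega>. W 0 \<omega> - U \<omega>)" by (simp add: square_integrable_def)
  have "square_integrable M U"
    using square_integrable_diff[OF W[of 0] D'] by simp
  moreover have "(\<lambda>n. \<integral>\<omega>. (W n \<omega> - U \<omega>)\<^sup>2 \<partial>M) \<longlonglongrightarrow> 0"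
  proof (rule tendsto_sandwich[OF _ _ tendsto_const e0])
    have e_nn: "0 \<le> e n" for n using e[of n n] by simp
    have "ennreal (\<integral>\<omega>. (W n \<omega> - U \<omega>)\<^sup>2 \<partial>M) \<le> ennreal (e n)" for n
      using fatou[of n] sq[of n] by (subst nn_integral_eq_integral[symmetric]) auto
    then show "\<forall>\<^sub>F n in sequentially. (\<integral>\<omega>. (W n \<omega> - U \<omega>)\<^sup>2 \<partial>M) \<le> e n"
      using e_nn by (simp add: ennreal_le_iff)
  qed simp
  ultimately show thesis by (rule that)
qed

text \<open>
  Riesz representation on a linear subspace of \<open>L\<^sup>2\<close>. The functional is given by its graph \<open>G\<close>, so
  the subspace never has to be formed as a type or a quotient. The constant \<open>C\<close> bounds the squared
  norm: \<open>2 k - \<parallel>W\<parallel>\<^sup>2 \<le> C\<close> on a linear space is the same as \<open>k\<^sup>2 \<le> C \<parallel>W\<parallel>\<^sup>2\<close>. Minimizing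
  \<open>\<parallel>W\<parallel>\<^sup>2 - 2 k\<close> over \<open>G\<close> yields the representing element, since this is, up to a constant, the
  squared distance of \<open>W\<close> to it. The sequence \<open>V\<close> records that \<open>U\<close> lies in the closure of the
  subspace.
\<close>

lemma (in prob_space) Riesz_L2:
  fixes G :: "(('a \<Rightarrow> real) \<times> real) set"
  assumes ne: "G \<noteq> {}"
    and L2: "\<And>W k. (W, k) \<in> G \<Longrightarrow> square_integrable M W"
    and lin: "\<And>W k W' k' s t. (W, k) \<in> G \<Longrightarrow> (W', k') \<in> G \<Longrightarrow>
        (\<lambda>\<omega>. s * W \<omega> + t * W' \<omega>, s * k + t * k') \<in> G"
    and bound: "\<And>W k. (W, k) \<in> G \<Longrightarrow> 2 * k - (\<integral>\<omega>. (W \<omega>)\<^sup>2 \<partial>M) \<le> C"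
  obtains U V where "square_integrable M U" "\<And>W k. (W, k) \<in> G \<Longrightarrow> (\<integral>\<omega>. U \<omega> * W \<omega> \<partial>M) = k"
    "(\<integral>\<omega>. (U \<omega>)\<^sup>2 \<partial>M) \<le> C"
    "\<And>n::nat. V n \<in> fst ` G" "(\<lambda>n. \<integral>\<omega>. (V n \<omega> - U \<omega>)\<^sup>2 \<partial>M) \<longlonglongrightarrow> 0"
proof -
  define q where "q p = (\<integral>\<omega>. (fst p \<omega>)\<^sup>2 \<partial>M) - 2 * snd p" for p :: "('a \<Rightarrow> real) \<times> real"
  define d where "d = Inf (q ` G)"
  have bdd: "bdd_below (q ` G)"
    by (intro bdd_belowI2[where m = "- C"]) (use bound in \<open>force simp: q_def\<close>)
  have d_le: "d \<le> q p" if "p \<in> G" for p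
    unfolding d_def by (rule cInf_lower) (use that bdd in auto)
  have "\<exists>p\<in>G. q p < d + 1 / real (Suc n)" for n
    using cInf_lessD[of "q ` G" "d + 1 / real (Suc n)"] ne unfolding d_def by fastforce
  then obtain p where p: "\<And>n. p n \<in> G" "\<And>n. q (p n) < d + 1 / real (Suc n)" by metis
  define W where "W n = fst (p n)" for n
  define k where "k n = snd (p n)" for n
  have WG: "(W n, k n) \<in> G" for n using p(1) by (simp add: W_def k_def)
  note W = L2[OF WG]
  have W2: "integrable M (\<lambda>\<omega>. (W n \<omega>)\<^sup>2)" for n using W[of n] by (simp add: square_integrable_def)
  have qW: "q (W n, k n) < d + 1 / real (Suc n)" for n using p(2) by (simp add: W_def k_def)
  define e where "e n = 2 * (1 / real (Suc n))" for n
  have e: "e \<longlonglongrightarrow> 0" unfolding e_def using tendsto_mult_right_zero[OF LIMSEQ_Suc[OF lim_1_over_n]] by simp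
  \<comment> \<open>parallelogram law: the midpoint of two nearly minimal elements cannot be below the infimum\<close>
  have par: "(\<integral>\<omega>. (W m \<omega> - W n \<omega>)\<^sup>2 \<partial>M) \<le> e m + e n" for m n
  proof -
    have "(\<integral>\<omega>. (1/2 * W m \<omega> + 1/2 * W n \<omega>)\<^sup>2 \<partial>M) + (\<integral>\<omega>. (1/4) * (W m \<omega> - W n \<omega>)\<^sup>2 \<partial>M)
        = (\<integral>\<omega>. (1/2 * W m \<omega> + 1/2 * W n \<omega>)\<^sup>2 + (1/4) * (W m \<omega> - W n \<omega>)\<^sup>2 \<partial>M)"
      using square_integrable_diff[OF W W, of m n]
        square_integrable_add[OF square_integrable_cmult[OF W] square_integrable_cmult[OF W], of "1/2" m "1/2" n]
      by (intro Bochner_Integration.integral_add[symmetric]) (auto simp: square_integrable_def)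
    also have "\<dots> = (\<integral>\<omega>. 1/2 * (W m \<omega>)\<^sup>2 + 1/2 * (W n \<omega>)\<^sup>2 \<partial>M)"
      by (rule Bochner_Integration.integral_cong) (auto simp: power2_eq_square field_simps)
    also have "\<dots> = 1/2 * (\<integral>\<omega>. (W m \<omega>)\<^sup>2 \<partial>M) + 1/2 * (\<integral>\<omega>. (W n \<omega>)\<^sup>2 \<partial>M)"
      using W2 by simp
    finally have "(\<integral>\<omega>. (1/2 * W m \<omega> + 1/2 * W n \<omega>)\<^sup>2 \<partial>M) + 1/4 * (\<integral>\<omega>. (W m \<omega> - W n \<omega>)\<^sup>2 \<partial>M)
       = 1/2 * (\<integral>\<omega>. (W m \<omega>)\<^sup>2 \<partial>M) + 1/2 * (\<integral>\<omega>. (W n \<omega>)\<^sup>2 \<partial>M)" by simp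
    then show ?thesis
      using d_le[OF lin[OF WG WG, of "1/2" m "1/2" n]] qW[of m] qW[of n]
      by (simp add: q_def e_def)
  qed
  obtain U where U: "square_integrable M U" and lim: "(\<lambda>n. \<integral>\<omega>. (W n \<omega> - U \<omega>)\<^sup>2 \<partial>M) \<longlonglongrightarrow> 0"
    using L2_complete[OF W par e] by blast
  have rep: "(\<integral>\<omega>. U \<omega> * X \<omega> \<partial>M) = k'" if XG: "(X, k') \<in> G" for X k'
  proof -
    note X = L2[OF XG]
    let ?b = "\<integral>\<omega>. U \<omega> * X \<omega> \<partial>M" and ?x = "\<integral>\<omega>. (X \<omega>)\<^sup>2 \<partial>M"
    have X2: "integrable M (\<lambda>\<omega>. (X \<omega>)\<^sup>2)" using X by (simp add: square_integrable_def)
    \<comment> \<open>perturb a nearly minimal element in the direction of \<open>X\<close>\<close>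
    have t: "0 \<le> 2 * t * (?b - k') + t\<^sup>2 * ?x" for t
    proof (rule tendsto_lowerbound)
      show "(\<lambda>n. 1 / real (Suc n) + (2 * t * ((\<integral>\<omega>. W n \<omega> * X \<omega> \<partial>M) - k') + t\<^sup>2 * ?x))
          \<longlonglongrightarrow> 2 * t * (?b - k') + t\<^sup>2 * ?x"
        by (rule tendsto_eq_intros LIMSEQ_Suc[OF lim_1_over_n] tendsto_expectation_mult[OF W U X lim] refl
              | simp)+
      have "0 \<le> 1 / real (Suc n) + (2 * t * ((\<integral>\<omega>. W n \<omega> * X \<omega> \<partial>M) - k') + t\<^sup>2 * ?x)" for n
      proof -
        have "(\<integral>\<omega>. (1 * W n \<omega> + t * X \<omega>)\<^sup>2 \<partial>M)
            = (\<integral>\<omega>. (W n \<omega>)\<^sup>2 + 2 * t * (W n \<omega> * X \<omega>) + t\<^sup>2 * (X \<omega>)\<^sup>2 \<partial>M)"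
          by (rule Bochner_Integration.integral_cong) (auto simp: power2_eq_square algebra_simps)
        also have "\<dots> = (\<integral>\<omega>. (W n \<omega>)\<^sup>2 \<partial>M) + 2 * t * (\<integral>\<omega>. W n \<omega> * X \<omega> \<partial>M) + t\<^sup>2 * ?x"
          using W2 X2 integrable_mult_square_integrable[OF W X] by simp
        finally show ?thesis
          using d_le[OF lin[OF WG XG, of 1 n t]] qW[of n] by (simp add: q_def algebra_simps)
      qed
      then show "\<forall>\<^sub>F n in sequentially. 0 \<le> 1 / real (Suc n) + (2 * t * ((\<integral>\<omega>. W n \<omega> * X \<omega> \<partial>M) - k') + t\<^sup>2 * ?x)"
        by simp
    qed simp
    have x: "0 \<le> ?x" by simp
    \<comment> \<open>the vertex would be \<open>t = - (?b - k') / ?x\<close>; the summand \<open>1\<close> covers the case \<open>?x = 0\<close>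
      and still leaves a negative value unless \<open>?b = k'\<close>\<close>
    have "0 \<le> 2 * (- (?b - k') / (?x + 1)) * (?b - k') + (- (?b - k') / (?x + 1))\<^sup>2 * ?x" by (rule t)
    also have "\<dots> = - ((?b - k')\<^sup>2 * (?x + 2)) / (?x + 1)\<^sup>2"
      using x by (simp add: field_simps power2_eq_square add_nonneg_eq_0_iff)
    finally have "(?b - k')\<^sup>2 * (?x + 2) \<le> 0" 
      using x by (auto simp: divide_le_0_iff)
    then have "(?b - k')\<^sup>2 \<le> 0" using x by (simp add: mult_le_0_iff)
    then show ?thesis by simp
  qed
  have UW: "(\<integral>\<omega>. (U \<omega>)\<^sup>2 \<partial>M) \<le> C"
  proof (rule tendsto_lowerbound)
    show "(\<lambda>n. C + (\<integral>\<omega>. (W n \<omega> - U \<omega>)\<^sup>2 \<partial>M)) \<longlonglongrightarrow> C"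
      using tendsto_add[OF tendsto_const lim, of C] by simp
    have "(\<integral>\<omega>. (U \<omega>)\<^sup>2 \<partial>M) \<le> C + (\<integral>\<omega>. (W n \<omega> - U \<omega>)\<^sup>2 \<partial>M)" for n
    proof -
      have "(\<integral>\<omega>. (W n \<omega> - U \<omega>)\<^sup>2 \<partial>M) = (\<integral>\<omega>. (W n \<omega>)\<^sup>2 - 2 * (U \<omega> * W n \<omega>) + (U \<omega>)\<^sup>2 \<partial>M)"
        by (rule Bochner_Integration.integral_cong) (auto simp: power2_eq_square algebra_simps)
      also have "\<dots> = (\<integral>\<omega>. (W n \<omega>)\<^sup>2 \<partial>M) - 2 * k n + (\<integral>\<omega>. (U \<omega>)\<^sup>2 \<partial>M)"
        using W2 U integrable_mult_square_integrable[OF U W] by (simp add: square_integrable_def rep[OF WG])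
      finally show ?thesis using bound[OF WG, of n] by simp
    qed
    then show "\<forall>\<^sub>F n in sequentially. (\<integral>\<omega>. (U \<omega>)\<^sup>2 \<partial>M) \<le> C + (\<integral>\<omega>. (W n \<omega> - U \<omega>)\<^sup>2 \<partial>M)"
      by simp
  qed simp
  have "W n \<in> fst ` G" for n using WG[of n] by (metis fst_conv imageI)
  then show thesis using that[OF U rep UW _ lim] by blast
qed

section \<open>Random fields with a prescribed covariance kernel\<close>

text \<open>
  Quantifying over sets of distinct points is as strong as quantifying over families with
  repetitions, because the coefficients of equal points can be added; it lets the coefficients be a
  function of the point.
\<close>

definition psd_kernel :: "('a \<Rightarrow> 'a \<Rightarrow> real) \<Rightarrow> bool" where
  "psd_kernel K \<longleftrightarrow> (\<forall>x y. K x y = K y x) \<and>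
     (\<forall>F c. finite F \<longrightarrow> 0 \<le> (\<Sum>x\<in>F. \<Sum>y\<in>F. c x * c y * K x y))"

lemma ex_orthonormal_family:
  obtains M :: "('a \<Rightarrow> bool) measure" and \<xi> :: "'a \<Rightarrow> ('a \<Rightarrow> bool) \<Rightarrow> real"
  where "prob_space M" "\<And>b. square_integrable M (\<xi> b)" "\<And>b. (\<integral>\<omega>. \<xi> b \<omega> \<partial>M) = 0"
    "\<And>b. (\<integral>\<omega>. \<xi> b \<omega> * \<xi> b \<omega> \<partial>M) = 1" "\<And>b c. b \<noteq> c \<Longrightarrow> (\<integral>\<omega>. \<xi> b \<omega> * \<xi> c \<omega> \<partial>M) = 0"
proof -
  define N where "N = measure_pmf (bernoulli_pmf (1/2))"
  define M where "M = PiM (UNIV :: 'a set) (\<lambda>_. N)"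
  define sgn' where "sgn' = (\<lambda>b. if b then 1 else - 1 :: real)"
  have N: "prob_space N" unfolding N_def by (rule measure_pmf.prob_space_axioms)
  have M: "prob_space M" unfolding M_def by (rule prob_space_PiM) (rule N)
  then interpret M: prob_space M .
  have sgn [measurable]: "sgn' \<in> borel_measurable N" unfolding N_def by simp
  have coord [measurable]: "(\<lambda>\<omega>. \<omega> b) \<in> measurable M N" for b
    unfolding M_def by (rule measurable_component_singleton) simp
  have distr: "distr M N (\<lambda>\<omega>. \<omega> b) = N" for b
    unfolding M_def by (rule distr_PiM_component) (simp_all add: N)
  have meas: "(\<lambda>\<omega>. sgn' (\<omega> b)) \<in> borel_measurable M" for b by measurable
  have int: "integrable M (\<lambda>\<omega>. sgn' (\<omega> b))" for b
    by (rule M.integrable_const_bound[where B = 1]) (auto simp: sgn'_def intro!: meas[unfolded sgn'_def])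
  have mean: "(\<integral>\<omega>. sgn' (\<omega> b) \<partial>M) = 0" for b
  proof -
    have "(\<integral>\<omega>. sgn' (\<omega> b) \<partial>M) = (\<integral>y. sgn' y \<partial>distr M N (\<lambda>\<omega>. \<omega> b))"
      by (subst integral_distr) simp_all
    also have "\<dots> = 0" unfolding distr by (simp add: N_def sgn'_def)
    finally show ?thesis .
  qed
  have "M.indep_vars (\<lambda>_. N) (\<lambda>b \<omega>. \<omega> b) UNIV"
    by (subst M.indep_vars_iff_distr_eq_PiM) (simp_all add: distr, simp add: M_def restrict_def)
  from M.indep_vars_compose2[OF this, of "\<lambda>_. sgn'" "\<lambda>_. borel"]
  have indep: "M.indep_vars (\<lambda>_. borel) (\<lambda>b \<omega>. sgn' (\<omega> b)) UNIV"
    by simp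
  have orth: "(\<integral>\<omega>. sgn' (\<omega> b) * sgn' (\<omega> c) \<partial>M) = 0" if "b \<noteq> c" for b c
    using M.indep_vars_lebesgue_integral[OF _ M.indep_vars_subset[OF indep, of "{b, c}"] int] that
    by (simp add: mean)
  have sq: "sgn' (\<omega> b) * sgn' (\<omega> b) = 1" for \<omega> b by (simp add: sgn'_def)
  show thesis
    by (rule that[of M "\<lambda>b \<omega>. sgn' (\<omega> b)"])
      (simp_all add: M mean orth sq square_integrable_def meas power2_eq_square M.prob_space)
qed

text \<open>
  One step of the Gram-Schmidt construction. The prescribed covariances \<open>K x y\<close> define a linear
  functional on the span of the variables \<open>Z y\<close>; positive semidefiniteness on the points of \<open>A\<close>
  together with \<open>x\<close> bounds its squared norm by \<open>K x x\<close>, so it is represented by some \<open>U\<close> with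
  \<open>\<parallel>U\<parallel>\<^sup>2 \<le> K x x\<close>. The missing variance is supplied by \<open>\<xi> x\<close>, which is orthogonal to everything built so far.
\<close>

lemma (in prob_space) extend_field:
  fixes K :: "'i \<Rightarrow> 'i \<Rightarrow> real"
  assumes K: "psd_kernel K"
    and \<xi>: "\<And>b. square_integrable M (\<xi> b)" "\<And>b. (\<integral>\<omega>. \<xi> b \<omega> \<partial>M) = 0"
      "\<And>b. (\<integral>\<omega>. \<xi> b \<omega> * \<xi> b \<omega> \<partial>M) = 1" "\<And>b c. b \<noteq> c \<Longrightarrow> (\<integral>\<omega>. \<xi> b \<omega> * \<xi> c \<omega> \<partial>M) = 0"
    and x: "x \<notin> A"
    and Z: "\<And>y. y \<in> A \<Longrightarrow> square_integrable M (Z y)" "\<And>y. y \<in> A \<Longrightarrow> (\<integral>\<omega>. Z y \<omega> \<partial>M) = 0"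
      "\<And>y b. y \<in> A \<Longrightarrow> b \<notin> A \<Longrightarrow> (\<integral>\<omega>. Z y \<omega> * \<xi> b \<omega> \<partial>M) = 0"
      "\<And>y z. y \<in> A \<Longrightarrow> z \<in> A \<Longrightarrow> (\<integral>\<omega>. Z y \<omega> * Z z \<omega> \<partial>M) = K y z"
  obtains X where "square_integrable M X" "(\<integral>\<omega>. X \<omega> \<partial>M) = 0"
      "\<And>b. b \<notin> insert x A \<Longrightarrow> (\<integral>\<omega>. X \<omega> * \<xi> b \<omega> \<partial>M) = 0"
      "(\<integral>\<omega>. X \<omega> * X \<omega> \<partial>M) = K x x"
      "\<And>y. y \<in> A \<Longrightarrow> (\<integral>\<omega>. X \<omega> * Z y \<omega> \<partial>M) = K x y"
proof -
  have sym: "K y z = K z y" for y z using K by (simp add: psd_kernel_def)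
  define comb where "comb F c = (\<lambda>\<omega>. \<Sum>y\<in>F. c y * Z y \<omega>)" for F and c :: "'i \<Rightarrow> real"
  define val where "val F c = (\<Sum>y\<in>F. c y * K x y)" for F and c :: "'i \<Rightarrow> real"
  define G where "G = {(comb F c, val F c) | F c. finite F \<and> F \<subseteq> A}"
  have comb_L2: "square_integrable M (comb F c)" if "F \<subseteq> A" for F c
    unfolding comb_def by (intro square_integrable_sum square_integrable_cmult Z) (use that in auto)
  have comb_mult: "(\<integral>\<omega>. comb F c \<omega> * Y \<omega> \<partial>M) = (\<Sum>y\<in>F. c y * (\<integral>\<omega>. Z y \<omega> * Y \<omega> \<partial>M))"
    if "F \<subseteq> A" "square_integrable M Y" for F c Y
  proof -
    have "integrable M (\<lambda>\<omega>. Z y \<omega> * Y \<omega>)" if "y \<in> F" for y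
      using that \<open>F \<subseteq> A\<close> \<open>square_integrable M Y\<close> by (intro integrable_mult_square_integrable Z) auto
    then show ?thesis
      by (simp add: comb_def sum_distrib_right mult.assoc)
  qed
  have one: "square_integrable M (\<lambda>_. 1)" by (simp add: square_integrable_def)
  have G_L2: "square_integrable M W" if "(W, k) \<in> G" for W k
    using that comb_L2 by (auto simp: G_def)
  have G_lin: "(\<lambda>\<omega>. s * W \<omega> + t * W' \<omega>, s * k + t * k') \<in> G"
    if WG: "(W, k) \<in> G" and WG': "(W', k') \<in> G" for W k W' k' s t
  proof -
    obtain F c where F: "finite F" "F \<subseteq> A" "W = comb F c" "k = val F c" using WG by (auto simp: G_def)
    obtain F' c' where F': "finite F'" "F' \<subseteq> A" "W' = comb F' c'" "k' = val F' c'" using WG' by (auto simp: G_def)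
    define c'' where "c'' y = s * (if y \<in> F then c y else 0) + t * (if y \<in> F' then c' y else 0)" for y
    have "(\<Sum>y\<in>F \<union> F'. c'' y * h y) = s * (\<Sum>y\<in>F. c y * h y) + t * (\<Sum>y\<in>F'. c' y * h y)" for h :: "'i \<Rightarrow> real"
    proof -
      have "(\<Sum>y\<in>F. c y * h y) = (\<Sum>y\<in>F \<union> F'. (if y \<in> F then c y else 0) * h y)"
        using F(1) F'(1) by (intro sum.mono_neutral_cong_left) auto
      moreover have "(\<Sum>y\<in>F'. c' y * h y) = (\<Sum>y\<in>F \<union> F'. (if y \<in> F' then c' y else 0) * h y)"
        using F(1) F'(1) by (intro sum.mono_neutral_cong_left) auto
      ultimately show ?thesis
        by (simp only: c''_def distrib_right sum.distrib sum_distrib_left mult.assoc)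
    qed
    then have "(\<lambda>\<omega>. s * W \<omega> + t * W' \<omega>) = comb (F \<union> F') c''" "s * k + t * k' = val (F \<union> F') c''"
      by (simp_all add: comb_def val_def F F')
    then show ?thesis using F F' by (auto simp: G_def)
  qed
  have G_bound: "2 * k - (\<integral>\<omega>. (W \<omega>)\<^sup>2 \<partial>M) \<le> K x x" if WG: "(W, k) \<in> G" for W k
  proof -
    obtain F c where F: "finite F" "F \<subseteq> A" "W = comb F c" "k = val F c" using WG by (auto simp: G_def)
    have xF: "x \<notin> F" using F x by auto
    \<comment> \<open>the coefficient \<open>- 1\<close> at the new point turns the quadratic form into the squared
      distance between the combination and the variable to be constructed\<close>
    define c' where "c' = c(x := - 1)"
    have c': "c' x = - 1" "\<And>y. y \<in> F \<Longrightarrow> c' y = c y" using xF by (auto simp: c'_def)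
    have "0 \<le> (\<Sum>y\<in>insert x F. \<Sum>z\<in>insert x F. c' y * c' z * K y z)"
      using K F(1) by (simp add: psd_kernel_def)
    also have "\<dots> = K x x - (\<Sum>z\<in>F. c z * K x z) - (\<Sum>y\<in>F. c y * K y x) + (\<Sum>y\<in>F. \<Sum>z\<in>F. c y * c z * K y z)"
      using F(1) xF by (simp add: c' sum.distrib sum_negf sum_subtractf)
    also have "\<dots> = K x x - 2 * k + (\<Sum>y\<in>F. \<Sum>z\<in>F. c y * c z * K y z)"
    proof -
      have "(\<Sum>y\<in>F. c y * K y x) = (\<Sum>y\<in>F. c y * K x y)"
        by (intro sum.cong refl) (subst sym, rule refl)
      then show ?thesis by (simp add: F(4) val_def)
    qed
    also have "(\<Sum>y\<in>F. \<Sum>z\<in>F. c y * c z * K y z) = (\<integral>\<omega>. W \<omega> * W \<omega> \<partial>M)"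
    proof -
      have "(\<integral>\<omega>. W \<omega> * W \<omega> \<partial>M) = (\<Sum>y\<in>F. c y * (\<integral>\<omega>. comb F c \<omega> * Z y \<omega> \<partial>M))"
        using comb_mult[OF F(2) comb_L2[OF F(2)]] F(3) by (simp add: mult.commute)
      also have "\<dots> = (\<Sum>y\<in>F. c y * (\<Sum>z\<in>F. c z * K z y))"
      proof (intro sum.cong refl arg_cong2[of _ _ _ _ "(*)"])
        fix y assume "y \<in> F"
        then have y: "y \<in> A" using F(2) by blast
        show "(\<integral>\<omega>. comb F c \<omega> * Z y \<omega> \<partial>M) = (\<Sum>z\<in>F. c z * K z y)"
          unfolding comb_mult[OF F(2) Z(1)[OF y]] using Z(4)[OF _ y] F(2)
          by (intro sum.cong) auto
      qed
      also have "\<dots> = (\<Sum>y\<in>F. \<Sum>z\<in>F. c y * c z * K y z)"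
        by (simp add: sum_distrib_left mult.assoc sym)
      finally show ?thesis by simp
    qed
    finally show ?thesis by (simp add: power2_eq_square)
  qed
  have "(comb {} (\<lambda>_. 0), val {} (\<lambda>_. 0)) \<in> G" unfolding G_def by blast
  then have G_ne: "G \<noteq> {}" by blast
  obtain U V where U: "square_integrable M U" "\<And>W k. (W, k) \<in> G \<Longrightarrow> (\<integral>\<omega>. U \<omega> * W \<omega> \<partial>M) = k"
      "(\<integral>\<omega>. (U \<omega>)\<^sup>2 \<partial>M) \<le> K x x"
    and V: "\<And>n::nat. V n \<in> fst ` G" "(\<lambda>n. \<integral>\<omega>. (V n \<omega> - U \<omega>)\<^sup>2 \<partial>M) \<longlonglongrightarrow> 0"
    by (rule Riesz_L2[of G "K x x"], rule G_ne, erule G_L2, erule (1) G_lin, erule G_bound) blast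
  have V_L2: "square_integrable M (V n)" for n using V(1)[of n] G_L2 by auto
  \<comment> \<open>\<open>U\<close> is a limit of elements of the span, so it inherits what they are orthogonal to\<close>
  have U_orth: "(\<integral>\<omega>. U \<omega> * Y \<omega> \<partial>M) = 0"
    if Y: "square_integrable M Y" "\<And>y. y \<in> A \<Longrightarrow> (\<integral>\<omega>. Z y \<omega> * Y \<omega> \<partial>M) = 0" for Y
  proof -
    have "(\<integral>\<omega>. V n \<omega> * Y \<omega> \<partial>M) = 0" for n
    proof -
      obtain F c where F: "F \<subseteq> A" "V n = comb F c" using V(1)[of n] by (auto simp: G_def)
      then show ?thesis using comb_mult[OF F(1) Y(1)] Y(2) by (auto intro!: sum.neutral)
    qed
    then show ?thesis
      using tendsto_expectation_mult[OF V_L2 U(1) Y(1) V(2)] by (simp add: LIMSEQ_const_iff)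
  qed
  have U_mean: "(\<integral>\<omega>. U \<omega> \<partial>M) = 0"
    using U_orth[OF one] Z(2) by simp
  have U_\<xi>: "(\<integral>\<omega>. U \<omega> * \<xi> b \<omega> \<partial>M) = 0" if "b \<notin> A" for b
    by (rule U_orth[OF \<xi>(1)]) (rule Z(3)[OF _ that])
  have U_Z: "(\<integral>\<omega>. U \<omega> * Z y \<omega> \<partial>M) = K x y" if "y \<in> A" for y
  proof (rule U(2))
    have "comb {y} (\<lambda>_. 1) = Z y" "val {y} (\<lambda>_. 1) = K x y" by (simp_all add: comb_def val_def)
    then show "(Z y, K x y) \<in> G" unfolding G_def using that
      by (intro CollectI exI[of _ "{y}"] exI[of _ "\<lambda>_. 1"]) simp
  qed
  define s where "s = sqrt (K x x - (\<integral>\<omega>. (U \<omega>)\<^sup>2 \<partial>M))"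
  define X where "X \<omega> = U \<omega> + s * \<xi> x \<omega>" for \<omega>
  have X_L2: "square_integrable M X"
    unfolding X_def by (intro square_integrable_add square_integrable_cmult U(1) \<xi>(1))
  have X_mult: "(\<integral>\<omega>. X \<omega> * Y \<omega> \<partial>M) = (\<integral>\<omega>. U \<omega> * Y \<omega> \<partial>M) + s * (\<integral>\<omega>. \<xi> x \<omega> * Y \<omega> \<partial>M)"
    if Y: "square_integrable M Y" for Y
    using integrable_mult_square_integrable[OF U(1) Y] integrable_mult_square_integrable[OF \<xi>(1) Y, of x]
    by (simp add: X_def distrib_right mult.assoc)
  show thesis
  proof (rule that[OF X_L2])
    show "(\<integral>\<omega>. X \<omega> \<partial>M) = 0"
      using X_mult[OF one] by (simp add: U_mean \<xi>(2))
    show "(\<integral>\<omega>. X \<omega> * \<xi> b \<omega> \<partial>M) = 0" if "b \<notin> insert x A" for b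
      using X_mult[OF \<xi>(1)] that by (auto simp: U_\<xi> \<xi>(4))
    show "(\<integral>\<omega>. X \<omega> * Z y \<omega> \<partial>M) = K x y" if "y \<in> A" for y
      using X_mult[OF Z(1)[OF that]] Z(3)[OF that x] by (simp add: U_Z[OF that] mult.commute)
    have "(\<integral>\<omega>. X \<omega> * X \<omega> \<partial>M) = (\<integral>\<omega>. X \<omega> * U \<omega> \<partial>M) + s * (\<integral>\<omega>. X \<omega> * \<xi> x \<omega> \<partial>M)"
      using X_mult[OF X_L2] by (simp add: mult.commute)
    also have "\<dots> = (\<integral>\<omega>. (U \<omega>)\<^sup>2 \<partial>M) + s\<^sup>2"
      using X_mult[OF U(1)] X_mult[OF \<xi>(1), of x] U_\<xi>[OF x]
      by (simp add: \<xi>(3) power2_eq_square mult.commute)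
    finally show "(\<integral>\<omega>. X \<omega> * X \<omega> \<partial>M) = K x x"
      using U(3) by (simp add: s_def)
  qed
qed

text \<open>
  Zorn's lemma is applied to partial fields, encoded as graphs \<open>R\<close> of pairs of a point and a random
  variable. All conditions on \<open>R\<close> concern at most two pairs at a time, and orthogonality to
  \<open>\<xi> b\<close> is required only for the points \<open>b\<close> that are still unused, so unions of chains are
  again admissible.
\<close>

theorem psd_kernel_imp_field:
  fixes K :: "'i \<Rightarrow> 'i \<Rightarrow> real"
  assumes K: "psd_kernel K"
  obtains M :: "('i \<Rightarrow> bool) measure" and Z where "prob_space M" "\<And>x. square_integrable M (Z x)"
    "\<And>x. (\<integral>\<omega>. Z x \<omega> \<partial>M) = 0" "\<And>x y. (\<integral>\<omega>. Z x \<omega> * Z y \<omega> \<partial>M) = K x y"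
proof -
  obtain M :: "('i \<Rightarrow> bool) measure" and \<xi> :: "'i \<Rightarrow> ('i \<Rightarrow> bool) \<Rightarrow> real" where M: "prob_space M"
    and \<xi>: "\<And>b. square_integrable M (\<xi> b)" "\<And>b. (\<integral>\<omega>. \<xi> b \<omega> \<partial>M) = 0"
      "\<And>b. (\<integral>\<omega>. \<xi> b \<omega> * \<xi> b \<omega> \<partial>M) = 1" "\<And>b c. b \<noteq> c \<Longrightarrow> (\<integral>\<omega>. \<xi> b \<omega> * \<xi> c \<omega> \<partial>M) = 0"
    using ex_orthonormal_family by blast
  interpret prob_space M by (rule M)
  have sym: "K y z = K z y" for y z using K by (simp add: psd_kernel_def)
  define good where "good R \<longleftrightarrow>
      (\<forall>x X. (x, X) \<in> R \<longrightarrow> square_integrable M X \<and> (\<integral>\<omega>. X \<omega> \<partial>M) = 0 \<and>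
         (\<forall>b. b \<notin> Domain R \<longrightarrow> (\<integral>\<omega>. X \<omega> * \<xi> b \<omega> \<partial>M) = 0)) \<and>
      (\<forall>x X y Y. (x, X) \<in> R \<longrightarrow> (y, Y) \<in> R \<longrightarrow> (\<integral>\<omega>. X \<omega> * Y \<omega> \<partial>M) = K x y \<and> (x = y \<longrightarrow> X = Y))"
    for R :: "('i \<times> (('i \<Rightarrow> bool) \<Rightarrow> real)) set"
  have goodD: "square_integrable M X" "(\<integral>\<omega>. X \<omega> \<partial>M) = 0"
      "b \<notin> Domain R \<Longrightarrow> (\<integral>\<omega>. X \<omega> * \<xi> b \<omega> \<partial>M) = 0" if "good R" "(x, X) \<in> R" for R x X b
    using that unfolding good_def by blast+
  have goodD2: "(\<integral>\<omega>. X \<omega> * Y \<omega> \<partial>M) = K x y" "x = y \<Longrightarrow> X = Y"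
    if "good R" "(x, X) \<in> R" "(y, Y) \<in> R" for R x X y Y
    using that unfolding good_def by blast+
  have "\<exists>R\<in>Collect good. \<forall>R'\<in>Collect good. R \<subseteq> R' \<longrightarrow> R' = R"
  proof (rule subset_Zorn')
    fix C assume C: "subset.chain (Collect good) C"
    then have gC: "good R" if "R \<in> C" for R using that by (auto simp: subset.chain_def)
    have one: "square_integrable M X \<and> (\<integral>\<omega>. X \<omega> \<partial>M) = 0 \<and>
        (\<forall>b. b \<notin> Domain (\<Union>C) \<longrightarrow> (\<integral>\<omega>. X \<omega> * \<xi> b \<omega> \<partial>M) = 0)" if "(x, X) \<in> \<Union>C" for x X
    proof -
      obtain R where R: "R \<in> C" "(x, X) \<in> R" using \<open>(x, X) \<in> \<Union>C\<close> by auto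
      have "b \<notin> Domain R" if "b \<notin> Domain (\<Union>C)" for b using that R(1) by auto
      then show ?thesis using goodD[OF gC[OF R(1)] R(2)] by blast
    qed
    have two: "(\<integral>\<omega>. X \<omega> * Y \<omega> \<partial>M) = K x y \<and> (x = y \<longrightarrow> X = Y)"
      if xy: "(x, X) \<in> \<Union>C" "(y, Y) \<in> \<Union>C" for x X y Y
    proof -
      obtain R R' where R: "R \<in> C" "(x, X) \<in> R" "R' \<in> C" "(y, Y) \<in> R'" using xy by auto
      have "R \<subseteq> R' \<or> R' \<subseteq> R" using C R(1) R(3) by (auto simp: subset.chain_def)
      then obtain R'' where R'': "R'' \<in> C" "(x, X) \<in> R''" "(y, Y) \<in> R''" using R by blast
      show ?thesis using goodD2[OF gC[OF R''(1)] R''(2,3)] by blast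
    qed
    show "\<Union>C \<in> Collect good"
      unfolding good_def mem_Collect_eq by (intro conjI allI impI one two; assumption)
  qed
  then obtain R where R: "good R" and max: "\<And>R'. good R' \<Longrightarrow> R \<subseteq> R' \<Longrightarrow> R' = R" by auto
  define Z where "Z x = (SOME X. (x, X) \<in> R)" for x
  have ZR: "(x, Z x) \<in> R" if "x \<in> Domain R" for x
    using that unfolding Z_def by (metis DomainE someI)
  have RZ: "X = Z x \<and> x \<in> Domain R" if "(x, X) \<in> R" for x X
    using goodD2(2)[OF R that ZR refl] that by blast
  have "x \<in> Domain R" for x
  proof (rule ccontr)
    assume x: "x \<notin> Domain R"
    have Z: "square_integrable M (Z y)" "(\<integral>\<omega>. Z y \<omega> \<partial>M) = 0"
        "b \<notin> Domain R \<Longrightarrow> (\<integral>\<omega>. Z y \<omega> * \<xi> b \<omega> \<partial>M) = 0" if "y \<in> Domain R" for y b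
      using goodD[OF R ZR[OF that]] by blast+
    have ZZ: "(\<integral>\<omega>. Z y \<omega> * Z z \<omega> \<partial>M) = K y z" if "y \<in> Domain R" "z \<in> Domain R" for y z
      using goodD2(1)[OF R ZR[OF that(1)] ZR[OF that(2)]] .
    obtain X where X: "square_integrable M X" "(\<integral>\<omega>. X \<omega> \<partial>M) = 0"
      "\<And>b. b \<notin> insert x (Domain R) \<Longrightarrow> (\<integral>\<omega>. X \<omega> * \<xi> b \<omega> \<partial>M) = 0"
      "(\<integral>\<omega>. X \<omega> * X \<omega> \<partial>M) = K x x"
      "\<And>y. y \<in> Domain R \<Longrightarrow> (\<integral>\<omega>. X \<omega> * Z y \<omega> \<partial>M) = K x y"
      by (rule extend_field[where Z = Z and A = "Domain R" and \<xi> = \<xi> and x = x, OF K],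
          rule \<xi>(1), rule \<xi>(2), rule \<xi>(3), erule \<xi>(4), rule x,
          erule Z(1), erule Z(2), erule (1) Z(3), erule (1) ZZ) blast
    have XY: "(\<integral>\<omega>. X \<omega> * Y \<omega> \<partial>M) = K x y" "(\<integral>\<omega>. Y \<omega> * X \<omega> \<partial>M) = K y x" "y \<noteq> x"
      if "(y, Y) \<in> R" for y Y
    proof -
      have y: "Y = Z y" "y \<in> Domain R" using RZ[OF that] by auto
      show "(\<integral>\<omega>. X \<omega> * Y \<omega> \<partial>M) = K x y" unfolding y(1) by (rule X(5)[OF y(2)])
      then show "(\<integral>\<omega>. Y \<omega> * X \<omega> \<partial>M) = K y x" by (simp add: mult.commute sym)
      show "y \<noteq> x" using x y(2) by blast
    qed
    have "(x, Y) \<notin> R" for Y using x by blast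
    then have "good (insert (x, X) R)"
      unfolding good_def
      using X(1-4) XY goodD[OF R] goodD2[OF R] by (auto simp: Domain.simps)
    from max[OF this] have "(x, X) \<in> R" by blast
    then show False using x by blast
  qed
  then have "(x, Z x) \<in> R" for x using ZR by blast
  then show thesis
    using that[of M Z, OF M] goodD(1,2)[OF R] goodD2(1)[OF R] by blast
qed

section \<open>Closure properties of positive semidefinite kernels\<close>

lemma psd_kernelI:
  assumes "\<And>x y. K x y = K y x"
    and "\<And>F c. finite F \<Longrightarrow> 0 \<le> (\<Sum>x\<in>F. \<Sum>y\<in>F. c x * c y * K x y)"
  shows "psd_kernel K"
  using assms by (auto simp: psd_kernel_def)

lemma psd_kernel_sym: "psd_kernel K \<Longrightarrow> K x y = K y x"
  by (simp add: psd_kernel_def)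

lemma psd_kernel_nonneg: "psd_kernel K \<Longrightarrow> finite F \<Longrightarrow> 0 \<le> (\<Sum>x\<in>F. \<Sum>y\<in>F. c x * c y * K x y)"
  by (simp add: psd_kernel_def)

lemma psd_kernel_add:
  assumes K: "psd_kernel K" and L: "psd_kernel L"
  shows "psd_kernel (\<lambda>x y. K x y + L x y)"
proof (rule psd_kernelI)
  show "K x y + L x y = K y x + L y x" for x y
    using psd_kernel_sym[OF K, of x y] psd_kernel_sym[OF L, of x y] by simp
  show "0 \<le> (\<Sum>x\<in>F. \<Sum>y\<in>F. c x * c y * (K x y + L x y))" if F: "finite F" for F c
    using psd_kernel_nonneg[OF K F] psd_kernel_nonneg[OF L F] by (simp add: distrib_left sum.distrib)
qed

lemma psd_kernel_scale:
  assumes K: "psd_kernel K" and s: "0 \<le> s"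
  shows "psd_kernel (\<lambda>x y. s * K x y)"
proof (rule psd_kernelI)
  show "s * K x y = s * K y x" for x y using psd_kernel_sym[OF K, of x y] by simp
  show "0 \<le> (\<Sum>x\<in>F. \<Sum>y\<in>F. c x * c y * (s * K x y))" if F: "finite F" for F c
    using mult_nonneg_nonneg[OF s psd_kernel_nonneg[OF K F]]
    by (simp add: sum_distrib_left mult.left_commute)
qed

lemma psd_kernel_rank_one: "psd_kernel (\<lambda>x y. h x * h y)"
proof (rule psd_kernelI)
  show "0 \<le> (\<Sum>x\<in>F. \<Sum>y\<in>F. c x * c y * (h x * h y))" if F: "finite F" for F c
  proof -
    have "(\<Sum>x\<in>F. \<Sum>y\<in>F. c x * c y * (h x * h y)) = (\<Sum>x\<in>F. c x * h x)\<^sup>2"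
      by (simp add: power2_eq_square sum_product mult.assoc mult.left_commute)
    then show ?thesis by simp
  qed
qed simp

lemma psd_kernel_limit:
  assumes K: "\<And>n::nat. psd_kernel (K n)" and lim: "\<And>x y. (\<lambda>n. K n x y) \<longlonglongrightarrow> L x y"
  shows "psd_kernel L"
proof (rule psd_kernelI)
  show "L x y = L y x" for x y
    by (rule LIMSEQ_unique[OF lim]) (subst psd_kernel_sym[OF K], rule lim)
  show "0 \<le> (\<Sum>x\<in>F. \<Sum>y\<in>F. c x * c y * L x y)" if F: "finite F" for F c
  proof (rule LIMSEQ_le_const)
    show "(\<lambda>n. \<Sum>x\<in>F. \<Sum>y\<in>F. c x * c y * K n x y) \<longlonglongrightarrow> (\<Sum>x\<in>F. \<Sum>y\<in>F. c x * c y * L x y)"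
      by (intro tendsto_intros lim)
  qed (use psd_kernel_nonneg[OF K F] in blast)
qed

lemma psd_kernel_integral:
  fixes K :: "'t \<Rightarrow> 'a \<Rightarrow> 'a \<Rightarrow> real"
  assumes K: "\<And>t. t \<in> space M \<Longrightarrow> psd_kernel (K t)" and int: "\<And>x y. integrable M (\<lambda>t. K t x y)"
  shows "psd_kernel (\<lambda>x y. \<integral>t. K t x y \<partial>M)"
proof (rule psd_kernelI)
  show "(\<integral>t. K t x y \<partial>M) = (\<integral>t. K t y x \<partial>M)" for x y
    by (rule Bochner_Integration.integral_cong[OF refl]) (rule psd_kernel_sym[OF K])
  show "0 \<le> (\<Sum>x\<in>F. \<Sum>y\<in>F. c x * c y * (\<integral>t. K t x y \<partial>M))" if F: "finite F" for F c
  proof -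
    have "0 \<le> (\<integral>t. (\<Sum>x\<in>F. \<Sum>y\<in>F. c x * c y * K t x y) \<partial>M)"
      by (rule Bochner_Integration.integral_nonneg) (rule psd_kernel_nonneg[OF K F])
    also have "\<dots> = (\<Sum>x\<in>F. \<Sum>y\<in>F. c x * c y * (\<integral>t. K t x y \<partial>M))"
      using int by simp
    finally show ?thesis .
  qed
qed

text \<open>
  The Schur product theorem. Write \<open>K x y\<close> as the expectation of \<open>Z x * Z y\<close>; for each outcome the
  factors \<open>Z x\<close> and \<open>Z y\<close> can be absorbed into the coefficients of the quadratic form of \<open>L\<close>, so the
  product kernel is a mixture of positive semidefinite kernels.
\<close>

lemma psd_kernel_mult:
  assumes K: "psd_kernel K" and L: "psd_kernel L"
  shows "psd_kernel (\<lambda>x y. K x y * L x y)"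
proof -
  obtain M :: "('a \<Rightarrow> bool) measure" and Z where Z: "\<And>x. square_integrable M (Z x)" and KZ: "\<And>x y. (\<integral>\<omega>. Z x \<omega> * Z y \<omega> \<partial>M) = K x y"
    by (rule psd_kernel_imp_field[OF K]) blast
  have "psd_kernel (\<lambda>x y. \<integral>\<omega>. Z x \<omega> * Z y \<omega> * L x y \<partial>M)"
  proof (rule psd_kernel_integral)
    fix \<omega>
    show "psd_kernel (\<lambda>x y. Z x \<omega> * Z y \<omega> * L x y)"
    proof (rule psd_kernelI)
      show "Z x \<omega> * Z y \<omega> * L x y = Z y \<omega> * Z x \<omega> * L y x" for x y
        using psd_kernel_sym[OF L, of x y] by simp
      show "0 \<le> (\<Sum>x\<in>F. \<Sum>y\<in>F. c x * c y * (Z x \<omega> * Z y \<omega> * L x y))" if F: "finite F" for F c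
        using psd_kernel_nonneg[OF L F, of "\<lambda>x. c x * Z x \<omega>"]
        by (simp add: mult.assoc mult.left_commute)
    qed
  next
    show "integrable M (\<lambda>\<omega>. Z x \<omega> * Z y \<omega> * L x y)" for x y
      using integrable_mult_square_integrable[OF Z Z] by simp
  qed
  then show ?thesis by (simp add: KZ)
qed

lemma psd_kernel_one: "psd_kernel (\<lambda>x y. 1)"
  using psd_kernel_rank_one[of "\<lambda>_. 1"] by simp

lemma psd_kernel_power:
  assumes "psd_kernel K"
  shows "psd_kernel (\<lambda>x y. K x y ^ n)"
  by (induction n) (simp_all add: psd_kernel_one psd_kernel_mult[OF assms])

lemma psd_kernel_sum:
  assumes "\<And>i. i \<in> I \<Longrightarrow> psd_kernel (K i)"
  shows "psd_kernel (\<lambda>x y. \<Sum>i\<in>I. K i x y)"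
  using assms
proof (induction I rule: infinite_finite_induct)
  case (insert i I)
  then show ?case using psd_kernel_add[of "K i" "\<lambda>x y. \<Sum>i\<in>I. K i x y"] by simp
qed (use psd_kernel_rank_one[of "\<lambda>_. 0"] in simp_all)

lemma psd_kernel_exp:
  assumes "psd_kernel K"
  shows "psd_kernel (\<lambda>x y. exp (K x y))"
proof (rule psd_kernel_limit)
  show "psd_kernel (\<lambda>x y. \<Sum>k<n. K x y ^ k /\<^sub>R fact k)" for n
    unfolding real_scaleR_def by (intro psd_kernel_sum psd_kernel_scale psd_kernel_power assms) simp
  show "(\<lambda>n. \<Sum>k<n. K x y ^ k /\<^sub>R fact k) \<longlonglongrightarrow> exp (K x y)" for x y
    using exp_converges[of "K x y"] by (simp add: sums_def)
qed

section \<open>Conditionally negative definite kernels\<close>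

definition cnd_kernel :: "('a \<Rightarrow> 'a \<Rightarrow> real) \<Rightarrow> bool" where
  "cnd_kernel L \<longleftrightarrow> (\<forall>x y. L x y = L y x) \<and>
     (\<forall>F c. finite F \<longrightarrow> (\<Sum>x\<in>F. c x) = 0 \<longrightarrow> (\<Sum>x\<in>F. \<Sum>y\<in>F. c x * c y * L x y) \<le> 0)"

lemma cnd_kernel_sym: "cnd_kernel L \<Longrightarrow> L x y = L y x"
  by (simp add: cnd_kernel_def)

lemma cnd_kernel_nonpos:
  "cnd_kernel L \<Longrightarrow> finite F \<Longrightarrow> (\<Sum>x\<in>F. c x) = 0 \<Longrightarrow> (\<Sum>x\<in>F. \<Sum>y\<in>F. c x * c y * L x y) \<le> 0"
  by (simp add: cnd_kernel_def)

lemma cnd_kernel_add_scale: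
  assumes K: "cnd_kernel K" and L: "cnd_kernel L" and s: "0 \<le> s"
  shows "cnd_kernel (\<lambda>x y. K x y + s * L x y)"
  unfolding cnd_kernel_def
proof (intro conjI allI impI)
  show "K x y + s * L x y = K y x + s * L y x" for x y
    using cnd_kernel_sym[OF K, of x y] cnd_kernel_sym[OF L, of x y] by simp
  show "(\<Sum>x\<in>F. \<Sum>y\<in>F. c x * c y * (K x y + s * L x y)) \<le> 0" if F: "finite F" "(\<Sum>x\<in>F. c x) = 0" for F c
  proof -
    have "(\<Sum>x\<in>F. \<Sum>y\<in>F. c x * c y * (K x y + s * L x y))
        = (\<Sum>x\<in>F. \<Sum>y\<in>F. c x * c y * K x y) + s * (\<Sum>x\<in>F. \<Sum>y\<in>F. c x * c y * L x y)"
      by (simp add: distrib_left sum.distrib sum_distrib_left mult.left_commute)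
    then show ?thesis
      using cnd_kernel_nonpos[OF K F] mult_nonneg_nonpos[OF s cnd_kernel_nonpos[OF L F]] by simp
  qed
qed

text \<open>
  A base point \<open>z\<close> is given the weight that makes the coefficients sum to \<open>0\<close>; the
  quadratic form of \<open>L\<close> for the modified coefficients is then minus that of the kernel below for
  the original ones.
\<close>

lemma cnd_kernel_imp_psd:
  assumes L: "cnd_kernel L"
  shows "psd_kernel (\<lambda>x y. L x z + L y z - L x y - L z z)"
proof (rule psd_kernelI)
  show "L x z + L y z - L x y - L z z = L y z + L x z - L y x - L z z" for x y
    using cnd_kernel_sym[OF L, of x y] by simp
  fix F :: "'a set" and c :: "'a \<Rightarrow> real"
  assume F: "finite F"
  \<comment> \<open>the modified coefficients are \<open>b - e\<close>; extending \<open>c\<close> by \<open>0\<close> to \<open>b\<close> handles the cases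
    \<open>z \<in> F\<close> and \<open>z \<notin> F\<close> at once\<close>
  define s where "s = (\<Sum>x\<in>F. c x)"
  define b where "b x = (if x \<in> F then c x else 0)" for x
  define e where "e x = (if x = z then s else 0)" for x
  let ?F = "insert z F"
  have F': "finite ?F" using F by simp
  have be: "(\<Sum>x\<in>?F. b x * h x) = (\<Sum>x\<in>F. c x * h x)" "(\<Sum>x\<in>?F. e x * h x) = s * h z" for h :: "'a \<Rightarrow> real"
  proof -
    show "(\<Sum>x\<in>?F. b x * h x) = (\<Sum>x\<in>F. c x * h x)"
      using F by (intro sum.mono_neutral_cong_right) (auto simp: b_def)
    show "(\<Sum>x\<in>?F. e x * h x) = s * h z"
      using F' by (subst sum.mono_neutral_cong_right[of _ "{z}" _ "\<lambda>x. s * h x"]) (auto simp: e_def)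
  qed
  have be': "(\<Sum>x\<in>?F. (b x - e x) * h x) = (\<Sum>x\<in>F. c x * h x) - s * h z" for h :: "'a \<Rightarrow> real"
    by (simp only: left_diff_distrib sum_subtractf be)
  have "(\<Sum>x\<in>?F. b x - e x) = 0"
    using be'[of "\<lambda>_. 1"] by (simp add: s_def)
  then have "(\<Sum>x\<in>?F. \<Sum>y\<in>?F. (b x - e x) * (b y - e y) * L x y) \<le> 0"
    by (rule cnd_kernel_nonpos[OF L F'])
  also have "(\<Sum>x\<in>?F. \<Sum>y\<in>?F. (b x - e x) * (b y - e y) * L x y)
      = (\<Sum>x\<in>?F. (b x - e x) * (\<Sum>y\<in>?F. (b y - e y) * L x y))"
    by (simp only: sum_distrib_left mult.assoc)
  also have "\<dots> = (\<Sum>x\<in>F. c x * ((\<Sum>y\<in>F. c y * L x y) - s * L x z)) - s * ((\<Sum>y\<in>F. c y * L z y) - s * L z z)"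
    by (simp only: be')
  also have "(\<Sum>y\<in>F. c y * L z y) = (\<Sum>x\<in>F. c x * L x z)"
    by (intro sum.cong refl arg_cong2[of _ _ _ _ "(*)"] cnd_kernel_sym[OF L])
  finally have le': "(\<Sum>x\<in>F. c x * ((\<Sum>y\<in>F. c y * L x y) - s * L x z)) - s * ((\<Sum>x\<in>F. c x * L x z) - s * L z z) \<le> 0" .
  have split: "(\<Sum>x\<in>F. c x * ((\<Sum>y\<in>F. c y * L x y) - s * L x z))
      = (\<Sum>x\<in>F. \<Sum>y\<in>F. c x * c y * L x y) - s * (\<Sum>x\<in>F. c x * L x z)"
    by (simp only: right_diff_distrib sum_subtractf) (simp add: sum_distrib_left mult.assoc mult.left_commute)
  have le: "(\<Sum>x\<in>F. \<Sum>y\<in>F. c x * c y * L x y) - 2 * s * (\<Sum>x\<in>F. c x * L x z) + s * s * L z z \<le> 0"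
    using le' unfolding split by (simp add: algebra_simps)
  have 1: "(\<Sum>x\<in>F. \<Sum>y\<in>F. c x * c y * L x z) = s * (\<Sum>x\<in>F. c x * L x z)"
    unfolding s_def sum_product by (subst sum.swap) (simp add: mult.left_commute mult.assoc)
  have 2: "(\<Sum>x\<in>F. \<Sum>y\<in>F. c x * c y * L y z) = s * (\<Sum>x\<in>F. c x * L x z)"
    unfolding s_def sum_product by (simp add: mult.assoc)
  have 3: "(\<Sum>x\<in>F. \<Sum>y\<in>F. c x * c y * L z z) = s * s * L z z"
    unfolding s_def sum_product by (simp add: sum_distrib_right)
  have "(\<Sum>x\<in>F. \<Sum>y\<in>F. c x * c y * (L x z + L y z - L x y - L z z))
     = 2 * s * (\<Sum>x\<in>F. c x * L x z) - (\<Sum>x\<in>F. \<Sum>y\<in>F. c x * c y * L x y) - s * s * L z z"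
    by (simp only: right_diff_distrib distrib_left sum_subtractf sum.distrib 1 2 3)
  then show "0 \<le> (\<Sum>x\<in>F. \<Sum>y\<in>F. c x * c y * (L x z + L y z - L x y - L z z))"
    using le by simp
qed

text \<open>
  Schoenberg's theorem: up to factors depending on only one of the two points, \<open>exp (- t L)\<close> is the
  exponential of the positive semidefinite kernel of \<open>cnd_kernel_imp_psd\<close>.
\<close>

lemma psd_kernel_exp_neg:
  assumes L: "cnd_kernel L" and t: "0 \<le> t"
  shows "psd_kernel (\<lambda>x y. exp (- (t * L x y)))"
proof -
  obtain z :: 'a where True by simp
  let ?K = "\<lambda>x y. L x z + L y z - L x y - L z z"
  have "psd_kernel (\<lambda>x y. exp (t * L z z) * ((exp (- t * L x z) * exp (- t * L y z)) * exp (t * ?K x y)))"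
    by (intro psd_kernel_scale[where s = "exp (t * L z z)"] psd_kernel_mult psd_kernel_rank_one psd_kernel_exp
        psd_kernel_scale[OF cnd_kernel_imp_psd[OF L] t]) simp
  moreover have "exp (t * L z z) * ((exp (- t * L x z) * exp (- t * L y z)) * exp (t * ?K x y)) = exp (- (t * L x y))" for x y
    by (simp add: exp_add[symmetric] algebra_simps)
  ultimately show ?thesis by simp
qed

text \<open>
  Euler's integral after the substitution \<open>t \<mapsto> x t\<close>; up to the factor \<open>Gamma s\<close>, it
  represents \<open>x powr (- s)\<close> as a mixture of exponentials with nonnegative weights.
\<close>

lemma Gamma_integral_scaled:
  assumes s: "0 < s" and x: "(0::real) < x"
  shows "has_bochner_integral lborel (\<lambda>t. indicator {0..} t * t powr (s - 1) * exp (- (t * x))) (Gamma s * x powr (- s))"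
proof -
  let ?h = "\<lambda>t::real. indicator {0..} t * t powr (s - 1) / exp t :: real"
  have "has_bochner_integral lborel ?h (Gamma s)"
    using Gamma_conv_nn_integral_real[OF s] Gamma_real_pos[OF s]
    by (intro has_bochner_integral_nn_integral) (auto simp: indicator_def)
  then have "has_bochner_integral lborel (\<lambda>t. ?h (0 + x * t)) (Gamma s /\<^sub>R \<bar>x\<bar>)"
    using lborel_has_bochner_integral_real_affine_iff[of x ?h "Gamma s" 0] x by simp
  from has_bochner_integral_mult_right[OF this, of "x powr (1 - s)"]
  have *: "has_bochner_integral lborel (\<lambda>t. x powr (1 - s) * ?h (0 + x * t)) (x powr (1 - s) * (Gamma s /\<^sub>R \<bar>x\<bar>))"
    by simp
  have "x powr (1 - s) * (Gamma s /\<^sub>R \<bar>x\<bar>) = Gamma s * x powr (- s)"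
    using x by (simp add: powr_diff powr_minus field_simps)
  moreover have "x powr (1 - s) * ?h (0 + x * t) = indicator {0..} t * t powr (s - 1) * exp (- (t * x))" for t
    using x by (cases "t \<ge> 0")
      (auto simp: indicator_def powr_mult powr_diff exp_minus field_simps zero_le_mult_iff)
  ultimately show ?thesis using * by (simp del: real_scaleR_def)
qed

lemma psd_kernel_powr_neg:
  assumes L: "cnd_kernel L" and pos: "\<And>x y. 0 < L x y" and s: "0 \<le> s"
  shows "psd_kernel (\<lambda>x y. L x y powr (- s))"
proof (cases "s = 0")
  case True
  then show ?thesis using pos by (simp add: psd_kernel_one less_imp_neq[symmetric])
next
  case False
  then have s: "0 < s" using s by simp
  let ?k = "\<lambda>t x y. indicator {0..} t * t powr (s - 1) * exp (- (t * L x y)) :: real"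
  note int = Gamma_integral_scaled[OF s pos]
  have "psd_kernel (\<lambda>x y. \<integral>t. ?k t x y \<partial>lborel)"
  proof (rule psd_kernel_integral)
    show "psd_kernel (?k t)" for t
    proof (cases "t \<ge> 0")
      case True
      then show ?thesis by (intro psd_kernel_scale psd_kernel_exp_neg L) auto
    next
      case False
      then show ?thesis using psd_kernel_scale[OF psd_kernel_one, of 0] by simp
    qed
    show "integrable lborel (\<lambda>t. ?k t x y)" for x y
      using int[of x y] by (simp add: has_bochner_integral_iff)
  qed
  then have "psd_kernel (\<lambda>x y. Gamma s * L x y powr (- s))"
    by (simp add: has_bochner_integral_integral_eq[OF int])
  from psd_kernel_scale[OF this, of "1 / Gamma s"] Gamma_real_pos[OF s]
  show ?thesis by simp
qed

section \<open>Matrix-valued functions as scalar kernels\<close>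

lemma psd_kernel_matrix:
  fixes A :: "real ^ 'm::finite ^ 'm" and \<pi> :: "'a \<Rightarrow> 'm"
  assumes A: "psd_matrix A"
  shows "psd_kernel (\<lambda>x y. A $ \<pi> x $ \<pi> y)"
proof (rule psd_kernelI)
  have "A $ i $ j = transpose A $ j $ i" for i j by (simp add: transpose_def)
  then show "A $ \<pi> x $ \<pi> y = A $ \<pi> y $ \<pi> x" for x y
    using A by (simp add: psd_matrix_def)
  fix F :: "'a set" and c :: "'a \<Rightarrow> real"
  define w where "w = (\<Sum>x\<in>F. c x *\<^sub>R axis (\<pi> x) (1::real))"
  have "A *v w = (\<Sum>y\<in>F. c y *\<^sub>R column (\<pi> y) A)"
    unfolding w_def
    by (simp add: linear_sum[OF matrix_vector_mul_linear] matrix_vector_mult_scaleR matrix_vector_mult_basis)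
  then have "w \<bullet> (A *v w) = (\<Sum>y\<in>F. c y * (\<Sum>x\<in>F. c x * A $ \<pi> x $ \<pi> y))"
    by (simp add: inner_sum_right) (simp add: w_def inner_sum_left inner_axis' column_def)
  also have "\<dots> = (\<Sum>x\<in>F. \<Sum>y\<in>F. c x * c y * A $ \<pi> x $ \<pi> y)"
    by (simp only: sum_distrib_left, subst sum.swap) (simp add: mult.assoc mult.left_commute)
  finally have "w \<bullet> (A *v w) = (\<Sum>x\<in>F. \<Sum>y\<in>F. c x * c y * A $ \<pi> x $ \<pi> y)" .
  then show "0 \<le> (\<Sum>x\<in>F. \<Sum>y\<in>F. c x * c y * A $ \<pi> x $ \<pi> y)"
    using A by (metis psd_matrix_def)
qed

text \<open>
  The map \<open>p\<close> selects the part of a point on which \<open>\<gamma>\<close> depends. For a coordinate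
  projection many points of \<open>F\<close> share one location, so \<open>F\<close> has to be enumerated instead of being
  mapped to a set of locations. Scalar
  coefficients \<open>c\<close> become the vectors \<open>c x *\<^sub>R axis (\<pi> x) 1\<close>, whose entries sum to \<open>c x\<close>.
\<close>

lemma cond_neg_def_imp_cnd_kernel:
  fixes \<gamma> :: "'b::euclidean_space \<Rightarrow> real ^ 'm::finite ^ 'm" and p :: "'a \<Rightarrow> 'b" and \<pi> :: "'a \<Rightarrow> 'm"
  assumes \<gamma>: "cond_neg_def \<gamma>"
  shows "cnd_kernel (\<lambda>x y. \<gamma> (p x - p y) $ \<pi> x $ \<pi> y)"
  unfolding cnd_kernel_def
proof (intro conjI allI impI)
  have "\<gamma> h $ i $ j = \<gamma> (- h) $ j $ i" for h i j using \<gamma> unfolding cond_neg_def_def by blast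
  from this[of "p x - p y" for x y]
  show "\<gamma> (p x - p y) $ \<pi> x $ \<pi> y = \<gamma> (p y - p x) $ \<pi> y $ \<pi> x" for x y
    by simp
  fix F :: "'a set" and c :: "'a \<Rightarrow> real"
  assume F: "finite F" and c: "(\<Sum>x\<in>F. c x) = 0"
  obtain e where e: "bij_betw e {0..<card F} F" using ex_bij_betw_nat_finite[OF F] by blast
  then have e: "bij_betw e {..<card F} F" by (simp add: atLeast0LessThan)
  define a where "a k = c (e k) *\<^sub>R axis (\<pi> (e k)) (1::real)" for k
  have "1 \<bullet> (\<Sum>k<card F. a k) = (\<Sum>k<card F. c (e k))"
    by (simp add: a_def inner_sum_right inner_axis)
  also have "\<dots> = 0" using sum.reindex_bij_betw[OF e, of c] c by simp
  finally have le: "(\<Sum>i<card F. \<Sum>j<card F. a i \<bullet> (\<gamma> (p (e i) - p (e j)) *v a j)) \<le> 0"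
    using conjunct2[OF \<gamma>[unfolded cond_neg_def_def], rule_format,
        where n = "card F" and x = "\<lambda>k. p (e k)" and a = a] by simp
  have "a i \<bullet> (\<gamma> (p (e i) - p (e j)) *v a j)
      = c (e i) * c (e j) * \<gamma> (p (e i) - p (e j)) $ \<pi> (e i) $ \<pi> (e j)" for i j
    by (simp add: a_def matrix_vector_mult_scaleR matrix_vector_mult_basis inner_axis' column_def)
  moreover have "(\<Sum>i<card F. \<Sum>j<card F. c (e i) * c (e j) * \<gamma> (p (e i) - p (e j)) $ \<pi> (e i) $ \<pi> (e j))
      = (\<Sum>x\<in>F. \<Sum>y\<in>F. c x * c y * \<gamma> (p x - p y) $ \<pi> x $ \<pi> y)"
    by (simp add: sum.reindex_bij_betw[OF e, of "\<lambda>y. c x * c y * \<gamma> (p x - p y) $ \<pi> x $ \<pi> y" for x]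
        sum.reindex_bij_betw[OF e, of "\<lambda>x. \<Sum>y\<in>F. c x * c y * \<gamma> (p x - p y) $ \<pi> x $ \<pi> y"])
  ultimately show "(\<Sum>x\<in>F. \<Sum>y\<in>F. c x * c y * \<gamma> (p x - p y) $ \<pi> x $ \<pi> y) \<le> 0"
    using le by simp
qed

theorem psd_kernel_imp_covariance_function:
  fixes C :: "'a::euclidean_space \<Rightarrow> real ^ 'm::finite ^ 'm"
  assumes "psd_kernel (\<lambda>(x, i) (y, j). C (x - y) $ i $ j)"
  shows "covariance_function C"
proof -
  obtain M :: "('a \<times> 'm \<Rightarrow> bool) measure" and Z where M: "prob_space M"
    and Z: "\<And>p. square_integrable M (Z p)" "\<And>p. (\<integral>\<omega>. Z p \<omega> \<partial>M) = 0"
      "\<And>p q. (\<integral>\<omega>. Z p \<omega> * Z q \<omega> \<partial>M) = (\<lambda>(x, i) (y, j). C (x - y) $ i $ j) p q"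
    by (rule psd_kernel_imp_field[OF assms]) blast
  have "stationary_field_with_cov M (\<lambda>x \<omega>. \<chi> i. Z (x, i) \<omega>) C"
    unfolding stationary_field_with_cov_def covariance_def
  proof (intro conjI allI)
    show "(\<lambda>\<omega>. \<chi> i. Z (x, i) \<omega>) \<in> borel_measurable M" for x
    proof -
      have [measurable]: "Z p \<in> borel_measurable M" for p by (rule square_integrable_measurable[OF Z(1)])
      have "(\<lambda>\<omega>. (\<chi> i. Z (x, i) \<omega>) \<bullet> b) \<in> borel_measurable M" if "b \<in> Basis" for b :: "real ^ 'm"
        using that by (auto simp: Basis_vec_def inner_axis)
      then show ?thesis by (subst borel_measurable_euclidean_space) blast
    qed
    show "\<exists>c::real ^ 'm. \<forall>x i. (\<integral>\<omega>. (\<chi> i. Z (x, i) \<omega>) $ i \<partial>M) = c $ i"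
      by (rule exI[of _ 0]) (simp add: Z(2))
  qed (use M Z in \<open>auto simp: square_integrable_def\<close>)
  then show ?thesis by (rule stationary_field_imp_covariance_function)
qed

section \<open>Generalized Stieltjes functions\<close>

lemma bounded_gen_stieltjes_integrable:
  assumes S: "bounded_gen_stieltjes_rep lam S a \<mu>" and lam: "0 < lam" and x: "0 \<le> x"
  shows "integrable \<mu> (\<lambda>v. 1 / (x + v) powr lam)"
proof -
  have sets: "sets \<mu> = sets (restrict_space borel {0<..})"
    and fin: "(\<integral>\<^sup>+ v. ennreal (v powr (- lam)) \<partial>\<mu>) < \<infinity>"
    using S by (auto simp: bounded_gen_stieltjes_rep_def)
  have space: "space \<mu> = {0<..}" using sets_eq_imp_space_eq[OF sets] by (simp add: space_restrict_space)
  have meas: "h \<in> borel_measurable \<mu>" if "h \<in> borel_measurable borel" for h :: "real \<Rightarrow> real"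
    using measurable_restrict_space1[OF that, of "{0<..}"] by (simp cong: measurable_cong_sets add: measurable_cong_sets[OF sets refl])
  show ?thesis
  proof (rule Bochner_Integration.integrable_bound)
    show "integrable \<mu> (\<lambda>v. v powr (- lam))"
      by (rule integrableI_nonneg) (use fin in \<open>auto intro!: meas\<close>)
    show "(\<lambda>v. 1 / (x + v) powr lam) \<in> borel_measurable \<mu>"
      by (rule meas) measurable
    show "AE v in \<mu>. norm (1 / (x + v) powr lam) \<le> norm (v powr (- lam))"
    proof (rule AE_I2)
      fix v assume "v \<in> space \<mu>"
      then have v: "0 < v" by (simp add: space)
      then have "(x + v) powr (- lam) \<le> v powr (- lam)"
        using x lam by (intro powr_mono2') auto
      then show "norm (1 / (x + v) powr lam) \<le> norm (v powr (- lam))"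
        by (simp add: powr_minus inverse_eq_divide)
    qed
  qed
qed

text \<open>
  The representation extends to \<open>x = 0\<close>: by dominated convergence both sides are right-continuous
  there. The value at \<open>0\<close> enters wherever \<open>g\<close> vanishes.
\<close>

lemma bounded_gen_stieltjes_eq:
  assumes S: "bounded_gen_stieltjes_rep lam S a \<mu>" and lam: "0 < lam" and x: "0 \<le> x"
  shows "S x = a + (\<integral>v. 1 / (x + v) powr lam \<partial>\<mu>)"
proof -
  have sets: "sets \<mu> = sets (restrict_space borel {0<..})"
    and eq: "\<And>x. x > 0 \<Longrightarrow> S x = a + (\<integral>v. 1 / (x + v) powr lam \<partial>\<mu>)"
    and cont: "continuous_on {0..} S"
    using S by (auto simp: bounded_gen_stieltjes_rep_def)
  have space: "space \<mu> = {0<..}" using sets_eq_imp_space_eq[OF sets] by (simp add: space_restrict_space)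
  note int = bounded_gen_stieltjes_integrable[OF S lam]
  let ?x = "\<lambda>n. x + 1 / real (Suc n)"
  have x_lim: "?x \<longlonglongrightarrow> x"
    using tendsto_add[OF tendsto_const LIMSEQ_Suc[OF lim_1_over_n], of x] by simp
  have x_pos: "?x n > 0" for n using x by (simp add: add_nonneg_pos)
  have "(\<lambda>n. S (?x n)) \<longlonglongrightarrow> S x"
    by (rule continuous_on_tendsto_compose[OF cont x_lim]) (use x x_pos in \<open>auto intro!: always_eventually less_imp_le\<close>)
  moreover have "(\<lambda>n. a + (\<integral>v. 1 / (?x n + v) powr lam \<partial>\<mu>)) \<longlonglongrightarrow> a + (\<integral>v. 1 / (x + v) powr lam \<partial>\<mu>)"
  proof (intro tendsto_intros integral_dominated_convergence[where w = "\<lambda>v. 1 / (x + v) powr lam"])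
    show "(\<lambda>v. 1 / (x + v) powr lam) \<in> borel_measurable \<mu>" "integrable \<mu> (\<lambda>v. 1 / (x + v) powr lam)"
      using int[OF x] by auto
    show "(\<lambda>v. 1 / (?x n + v) powr lam) \<in> borel_measurable \<mu>" for n
      using int[of "?x n"] x_pos[of n] by auto
    show "AE v in \<mu>. (\<lambda>n. 1 / (?x n + v) powr lam) \<longlonglongrightarrow> 1 / (x + v) powr lam"
      by (rule AE_I2, intro tendsto_divide tendsto_powr tendsto_const tendsto_add[OF x_lim tendsto_const])
        (use x in \<open>auto simp: space\<close>)
    show "AE v in \<mu>. norm (1 / (?x n + v) powr lam) \<le> 1 / (x + v) powr lam" for n
    proof (rule AE_I2)
      fix v assume "v \<in> space \<mu>"
      then have v: "0 < v" by (simp add: space)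
      then have "(?x n + v) powr (- lam) \<le> (x + v) powr (- lam)"
        using x lam by (intro powr_mono2') auto
      then show "norm (1 / (?x n + v) powr lam) \<le> 1 / (x + v) powr lam"
        by (simp add: powr_minus inverse_eq_divide)
    qed
  qed
  then have "(\<lambda>n. S (?x n)) \<longlonglongrightarrow> a + (\<integral>v. 1 / (x + v) powr lam \<partial>\<mu>)"
    using eq[OF x_pos] by simp
  ultimately show ?thesis by (rule LIMSEQ_unique)
qed

text \<open>
  After cancelling \<open>f\<close>, the integrand is a product of three factors: the density, a power of \<open>f\<close>
  and a power of \<open>g + v f\<close>. In this form each factor is a positive semidefinite kernel by itself.
\<close>

lemma scaled_stieltjes_eq:
  assumes S: "bounded_gen_stieltjes_rep lam S a \<mu>" and lam: "0 < lam"
    and \<phi>: "has_density_on_pos \<mu> \<phi>" and g: "0 \<le> g" and f: "0 < f"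
  shows "integrable (restrict_space lborel {0<..}) (\<lambda>v. \<phi> v * (f powr (- (r - lam)) * (g + v * f) powr (- lam)))" (is ?int)
    and "1 / f powr r * S (g / f) = a * f powr (- r)
      + (\<integral>v. \<phi> v * (f powr (- (r - lam)) * (g + v * f) powr (- lam)) \<partial>restrict_space lborel {0<..})" (is ?eq)
proof -
  let ?L = "restrict_space lborel {0<..} :: real measure"
  have meas: "\<phi> \<in> borel_measurable ?L" and nn: "AE v in ?L. 0 \<le> \<phi> v"
    and \<mu>: "\<mu> = density ?L (\<lambda>v. ennreal (\<phi> v))"
    using \<phi> by (auto simp: has_density_on_pos_def)
  have x: "0 \<le> g / f" using g f by simp
  have meas': "(\<lambda>v. 1 / (g / f + v) powr lam) \<in> borel_measurable ?L"
    by (rule measurable_restrict_space1) simp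
  have int: "integrable ?L (\<lambda>v. \<phi> v * (1 / (g / f + v) powr lam))"
    using bounded_gen_stieltjes_integrable[OF S lam x] integrable_density[OF meas' meas nn]
    unfolding \<mu> by simp
  have eq: "1 / f powr r * (\<phi> v * (1 / (g / f + v) powr lam))
      = \<phi> v * (f powr (- (r - lam)) * (g + v * f) powr (- lam))" if "v \<in> space ?L" for v
  proof -
    have v: "0 < v" using that by (simp add: space_restrict_space)
    have "g / f + v = (g + v * f) / f" using f by (simp add: field_simps)
    then have *: "(g / f + v) powr lam = (g + v * f) powr lam / f powr lam"
      using f g v by (simp add: powr_divide)
    show ?thesis
      unfolding * using f by (simp add: powr_minus powr_diff divide_simps)
  qed
  have "integrable ?L (\<lambda>v. 1 / f powr r * (\<phi> v * (1 / (g / f + v) powr lam)))"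
    by (rule integrable_mult_right[OF int])
  then show ?int
    by (subst (asm) Bochner_Integration.integrable_cong[OF refl eq])
  have "S (g / f) = a + (\<integral>v. \<phi> v * (1 / (g / f + v) powr lam) \<partial>?L)"
    using bounded_gen_stieltjes_eq[OF S lam x] integral_density[OF meas' meas nn] unfolding \<mu> by simp
  then have "1 / f powr r * S (g / f) = a * f powr (- r)
      + (\<integral>v. 1 / f powr r * (\<phi> v * (1 / (g / f + v) powr lam)) \<partial>?L)"
    by (simp add: powr_minus distrib_left divide_inverse mult.commute)
  also have "(\<integral>v. 1 / f powr r * (\<phi> v * (1 / (g / f + v) powr lam)) \<partial>?L)
      = (\<integral>v. \<phi> v * (f powr (- (r - lam)) * (g + v * f) powr (- lam)) \<partial>?L)"
    by (rule Bochner_Integration.integral_cong[OF refl eq])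
  finally show ?eq .
qed

section \<open>Covariance functions of Stieltjes type\<close>

theorem theorem4p3:
  fixes S :: "'m::finite \<Rightarrow> 'm \<Rightarrow> real \<Rightarrow> real"
    and a :: "real ^ 'm ^ 'm"
    and \<mu> :: "'m \<Rightarrow> 'm \<Rightarrow> real measure"
    and \<phi> :: "real \<Rightarrow> real ^ 'm ^ 'm"
    and g :: "real ^ 'd::finite \<Rightarrow> real ^ 'm ^ 'm"
    and f :: "real ^ 'l::finite \<Rightarrow> real ^ 'm ^ 'm"
    and lam r :: real
  assumes "lam > 0"
    and "\<And>i j. bounded_gen_stieltjes_rep lam (S i j) (a $ i $ j) (\<mu> i j)"
    and "psd_matrix a"
    and "\<And>i j. has_density_on_pos (\<mu> i j) (\<lambda>v. \<phi> v $ i $ j)"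
    and "\<And>v. v > 0 \<Longrightarrow> psd_matrix (\<phi> v)"
    and "\<And>h i j. g h $ i $ j \<ge> 0"
    and "\<And>u i j. f u $ i $ j > 0"
    and "cond_neg_def g"
    and "cond_neg_def f"
    and "r \<ge> lam"
  shows "covariance_function (\<lambda>(h :: real ^ 'd, u :: real ^ 'l).
           (\<chi> i j. 1 / (f u $ i $ j) powr r * S i j (g h $ i $ j / f u $ i $ j)) :: real ^ 'm ^ 'm)"
proof -
  let ?L = "restrict_space lborel {0<..} :: real measure"
  define \<Phi> where "\<Phi> x y = f (snd (fst x) - snd (fst y)) $ snd x $ snd y"
    for x y :: "((real ^ 'd) \<times> (real ^ 'l)) \<times> 'm"
  define \<Gamma> where "\<Gamma> x y = g (fst (fst x) - fst (fst y)) $ snd x $ snd y"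
    for x y :: "((real ^ 'd) \<times> (real ^ 'l)) \<times> 'm"
  have \<Phi>: "cnd_kernel \<Phi>" "\<And>x y. 0 < \<Phi> x y" and \<Gamma>: "cnd_kernel \<Gamma>" "\<And>x y. 0 \<le> \<Gamma> x y"
    using assms(6,7) cond_neg_def_imp_cnd_kernel[OF assms(9), of "\<lambda>x. snd (fst x)" snd]
      cond_neg_def_imp_cnd_kernel[OF assms(8), of "\<lambda>x. fst (fst x)" snd]
    unfolding \<Phi>_def \<Gamma>_def by auto
  let ?k = "\<lambda>v x y. \<phi> v $ snd x $ snd y * (\<Phi> x y powr (- (r - lam)) * (\<Gamma> x y + v * \<Phi> x y) powr (- lam))"
  note rep = scaled_stieltjes_eq[OF assms(2,1,4) \<Gamma>(2) \<Phi>(2), where r = r]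
  have "psd_kernel (\<lambda>x y. \<integral>v. ?k v x y \<partial>?L)"
  proof (rule psd_kernel_integral)
    fix v assume "v \<in> space ?L"
    then have v: "0 < v" by (simp add: space_restrict_space)
    have "cnd_kernel (\<lambda>x y. \<Gamma> x y + v * \<Phi> x y)"
      using v by (intro cnd_kernel_add_scale \<Gamma> \<Phi>) simp
    moreover have "0 < \<Gamma> x y + v * \<Phi> x y" for x y
      using \<Gamma>(2)[of x y] \<Phi>(2)[of x y] v by (simp add: add_nonneg_pos)
    ultimately show "psd_kernel (?k v)"
      using assms(1,10) by (intro psd_kernel_mult psd_kernel_matrix assms(5) v psd_kernel_powr_neg \<Phi>) auto
  qed (rule rep(1))
  then have "psd_kernel (\<lambda>x y. a $ snd x $ snd y * \<Phi> x y powr (- r) + (\<integral>v. ?k v x y \<partial>?L))"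
    using assms(1,10) by (intro psd_kernel_add psd_kernel_mult psd_kernel_matrix assms(3) psd_kernel_powr_neg \<Phi>) auto
  then have "psd_kernel (\<lambda>x y. 1 / \<Phi> x y powr r * S (snd x) (snd y) (\<Gamma> x y / \<Phi> x y))"
    by (simp only: rep(2))
  then show ?thesis
    by (intro psd_kernel_imp_covariance_function) (simp add: \<Phi>_def \<Gamma>_def case_prod_unfold)
qed

end
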